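(* There exists an absolute constant $\mathrm{c}>0$ such that the following holds for every probability space $(\Omega,\mathsf{A},\mu)$ and every filtration $\mathsf{A}_1\subset\mathsf{A}_2\subset\cdots$ of $\sigma$-subalgebras of $\mathsf{A}$. Let $f=(f_1,f_2,\ldots)$ be a martingale adapted to this filtration and bounded in $L_1(\Omega)$. Then there exist two martingales $g=(g_1,g_2,\ldots)$ and $h=(h_1,h_2,\ldots)$ adapted to the same filtration such that $f=g+h$ (i.e. $f_n=g_n+h_n$ for all $n\ge 1$) and $$\Big\| \Big( \sum_{k=1}^\infty \mathsf{E}_{k-1}(|dg_k|^2)\Big)^{1/2}\Big\|_{1,\infty} + \Big\| \sum_{k=1}^\infty |dh_k| \Big\|_{1,\infty} \le \mathrm{c}\,\|f\|_1 .$$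
   Context: Functions are complex-valued. $\mathsf{E}_k$ denotes the conditional expectation onto $\mathsf{A}_k$ for $k\ge1$, with the convention $\mathsf{E}_0=\mathsf{E}_1$. Conditional expectations of non-negative measurable functions are understood in the usual extended sense (values in $[0,\infty]$). A martingale $f=(f_1,f_2,\ldots)$ adapted to the filtration is a sequence of integrable functions with $f_n$ being $\mathsf{A}_n$-measurable and $\mathsf{E}_{n}(f_{n+1})=f_n$ for all $n\ge 1$. It is bounded in $L_1(\Omega)$ if $\|f\|_1:=\sup_n\|f_n\|_{L_1(\Omega)}<\infty$. Martingale differences are $df_k=f_k-f_{k-1}$ for $k\ge1$, with $f_0=0$ (and likewise $dg_k$, $dh_k$). For a measurable function $F$ on $\Omega$, $\|F\|_{1,\infty}=\|F\|_{L_{1,\infty}(\Omega)}=\sup_{\lambda>0}\lambda\,\mu\{|F|>\lambda\}$. *)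

theory Defs
  imports "HOL-Probability.Probability"
begin

text \<open>
  Sequences are indexed from 0: position \<open>n\<close> of a filtration or a martingale holds the
  object with mathematical index \<open>n + 1\<close>. Since \<open>0 - 1 = 0\<close> on natural numbers, the
  \<open>\<sigma>\<close>-algebra \<open>F (k - 1)\<close> then implements the convention \<open>E\<^sub>0 = E\<^sub>1\<close>.
\<close>

definition complex_cond_exp ::
    "'a measure \<Rightarrow> 'a measure \<Rightarrow> ('a \<Rightarrow> complex) \<Rightarrow> 'a \<Rightarrow> complex" where
  "complex_cond_exp M N f x =
     Complex (real_cond_exp M N (\<lambda>y. Re (f y)) x) (real_cond_exp M N (\<lambda>y. Im (f y)) x)"

definition martingale ::
    "'a measure \<Rightarrow> (nat \<Rightarrow> 'a measure) \<Rightarrow> (nat \<Rightarrow> 'a \<Rightarrow> complex) \<Rightarrow> bool" where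
  "martingale M F f \<longleftrightarrow>
     (\<forall>n. f n \<in> borel_measurable (F n) \<and> integrable M (f n) \<and>
          (AE x in M. complex_cond_exp M (F n) (f (Suc n)) x = f n x))"

definition martingale_L1_norm :: "'a measure \<Rightarrow> (nat \<Rightarrow> 'a \<Rightarrow> complex) \<Rightarrow> ennreal" where
  "martingale_L1_norm M f = (SUP n. \<integral>\<^sup>+x. ennreal (norm (f n x)) \<partial>M)"

definition mdiff :: "(nat \<Rightarrow> 'a \<Rightarrow> complex) \<Rightarrow> nat \<Rightarrow> 'a \<Rightarrow> complex" where
  "mdiff f k x = (if k = 0 then f 0 x else f k x - f (k - 1) x)"

definition ennreal_sqrt :: "ennreal \<Rightarrow> ennreal" where
  "ennreal_sqrt x = (if x = \<infinity> then \<infinity> else ennreal (sqrt (enn2real x)))"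

definition weak_L1_norm :: "'a measure \<Rightarrow> ('a \<Rightarrow> ennreal) \<Rightarrow> ennreal" where
  "weak_L1_norm M G =
     (SUP t\<in>{0::real<..}. ennreal t * emeasure M {x \<in> space M. ennreal t < G x})"

definition cond_square_function ::
    "'a measure \<Rightarrow> (nat \<Rightarrow> 'a measure) \<Rightarrow> (nat \<Rightarrow> 'a \<Rightarrow> complex) \<Rightarrow> 'a \<Rightarrow> ennreal" where
  "cond_square_function M F g x =
     ennreal_sqrt (\<Sum>k. nn_cond_exp M (F (k - 1)) (\<lambda>y. ennreal ((norm (mdiff g k y))\<^sup>2)) x)"

definition diff_sum :: "(nat \<Rightarrow> 'a \<Rightarrow> complex) \<Rightarrow> 'a \<Rightarrow> ennreal" where
  "diff_sum h x = (\<Sum>k. ennreal (norm (mdiff h k x)))"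

text \<open>
  A theorem \<open>\<exists>c. \<forall>M :: 'a measure. \<dots>\<close> would let \<open>c\<close> vary with the type \<open>'a\<close>, which HOL cannot
  quantify inside a formula. For the constant to be absolute, independent of the underlying
  set of the probability space as well, a bound on \<open>c\<close> that does not mention \<open>'a\<close> is
  included; its size is immaterial.
\<close>

end

theory Submission
  imports Defs
begin

text \<open>
  An \<open>L\<^sub>1\<close>-bounded martingale \<open>f\<close> is dominated by a non-negative martingale \<open>Y\<close> with
  \<open>E Y\<^sub>0 \<le> \<parallel>f\<parallel>\<^sub>1\<close> (\<open>martingale_majorant\<close>), and \<open>W\<^sub>n = max\<^bsub>k\<le>n\<^esub> Y\<^sub>k\<close> is in weak \<open>L\<^sub>1\<close> by
  Doob's inequality. The decomposition is Davis's, with \<open>W\<close> in the role of the maximal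
  function: an increment of \<open>f\<close> at a time when \<open>Y\<close> more than doubles its running maximum is a
  big jump; \<open>h\<close> is \<open>f\<^sub>0\<close> plus the compensated sum of the big jumps, and \<open>g = f - h\<close>. Taking \<open>Y\<close>
  rather than \<open>|f|\<close> as a gauge makes exact martingale identities available where \<open>|f|\<close> would
  only give a submartingale.

  The part \<open>g\<close>. Conditional expectations onto \<open>F\<^sub>k\<close> may be integrated over \<open>{W\<^sub>k \<le> t}\<close>, and there
  the small jumps that remain take place while \<open>W\<^bsub>k+1\<^esub> \<le> 2t\<close>. Increments of \<open>f\<close> before the
  passage of \<open>Y\<close> above level \<open>2t\<close> have total squared \<open>L\<^sub>2\<close> norm at most \<open>4t E Y\<^sub>0\<close>
  (\<open>sum_integral_sq_increment_below_le\<close>), so Chebyshev's inequality applies.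

  The part \<open>h\<close>. A big jump is at most \<open>3 (W\<^bsub>k+1\<^esub> - W\<^sub>k)\<close>, so the big jumps add up to at most \<open>3 W\<close>,
  and their compensators to at most \<open>3 \<Sum>\<^sub>k E\<^sub>k(W\<^bsub>k+1\<^esub> - W\<^sub>k)\<close>. The main point is that this
  predictable compensator of the running maximum is again in weak \<open>L\<^sub>1\<close>
  (\<open>prob_running_max_plus_compensator\<close>), although passing to compensators does not preserve weak
  \<open>L\<^sub>1\<close> in general, and the expectation of the compensator stopped at level \<open>l\<close> can grow like
  \<open>log l\<close>. At level \<open>l\<close>, split the increment of \<open>W\<close> into that of \<open>min W l\<close> and the overshoot
  above \<open>l\<close>. The overshoot happens once and has expectation at most \<open>E Y\<^sub>0\<close>. For \<open>min W l\<close> one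
  works in \<open>L\<^sub>2\<close>, where compensation costs a factor \<open>2\<close> in norm (\<open>integral_sq_sum_cond_exp_le\<close>),
  and \<open>E (min W l)\<^sup>2 \<le> 2 l E Y\<^sub>0\<close> (\<open>integral_truncated_running_max_sq_le\<close>).
\<close>

section \<open>Pathwise inequalities for the running maximum\<close>

primrec running_max :: "(nat \<Rightarrow> 'a \<Rightarrow> real) \<Rightarrow> nat \<Rightarrow> 'a \<Rightarrow> real" where
  "running_max Y 0 x = Y 0 x"
| "running_max Y (Suc n) x = max (running_max Y n x) (Y (Suc n) x)"

text \<open>
  The process \<open>Y\<close> stopped at its first passage above \<open>l\<close>. The recursion, which avoids naming the
  stopping time, turns optional stopping into an induction on \<open>n\<close>.
\<close>

primrec stopped_above :: "real \<Rightarrow> (nat \<Rightarrow> 'a \<Rightarrow> real) \<Rightarrow> nat \<Rightarrow> 'a \<Rightarrow> real" where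
  "stopped_above l Y 0 x = Y 0 x"
| "stopped_above l Y (Suc n) x =
     (if running_max Y n x \<le> l then Y (Suc n) x else stopped_above l Y n x)"

lemma le_running_max: "Y n x \<le> running_max Y n x"
  by (cases n) auto

lemma running_max_le_Suc: "running_max Y n x \<le> running_max Y (Suc n) x"
  by simp

lemma running_max_mono: "m \<le> n \<Longrightarrow> running_max Y m x \<le> running_max Y n x"
  by (rule lift_Suc_mono_le[of "\<lambda>n. running_max Y n x"]) (simp_all)

lemma running_max_nonneg: "(\<And>k. 0 \<le> Y k x) \<Longrightarrow> 0 \<le> running_max Y n x"
  by (meson le_running_max order_trans)

lemma running_max_le_sum:
  assumes "\<And>k. 0 \<le> Y k x"
  shows "running_max Y n x \<le> (\<Sum>k\<le>n. Y k x)"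
proof (induction n)
  case (Suc n)
  then show ?case using assms[of "Suc n"] sum_nonneg[of "{..n}" "\<lambda>k. Y k x"] assms
    by (simp add: add_increasing2)
qed simp

lemma stopped_above_before: "running_max Y n x \<le> l \<Longrightarrow> stopped_above l Y n x = Y n x"
  by (cases n) auto

lemma stopped_above_after: "l < running_max Y n x \<Longrightarrow> l < stopped_above l Y n x"
  by (induction n) (auto simp: max_def split: if_splits)

lemma stopped_above_nonneg: "(\<And>k. 0 \<le> Y k x) \<Longrightarrow> 0 \<le> stopped_above l Y n x"
  by (induction n) auto

lemma stopped_above_Suc_diff:
  "stopped_above l Y (Suc n) x =
     stopped_above l Y n x + indicat_real {y. running_max Y n y \<le> l} x * (Y (Suc n) x - Y n x)"
  by (auto simp: indicator_def stopped_above_before)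

text \<open>
  At most one term is non-zero, namely the one at the passage above \<open>l\<close>, where
  \<open>stopped_above\<close> has stopped at the value \<open>W\<^bsub>k+1\<^esub> = Y\<^bsub>k+1\<^esub>\<close>.
\<close>

lemma sum_overshoot_le_stopped_above:
  assumes "\<And>k. 0 \<le> Y k x" "0 \<le> l"
  shows "(\<Sum>k<N. indicat_real {y. running_max Y k y \<le> l} x * max 0 (running_max Y (Suc k) x - l))
           \<le> stopped_above l Y N x"
proof (induction N)
  case 0
  then show ?case using assms by simp
next
  case (Suc N)
  show ?case
  proof (cases "running_max Y N x \<le> l")
    case True
    have "indicat_real {y. running_max Y k y \<le> l} x * max 0 (running_max Y (Suc k) x - l) = 0"
      if "k < N" for k
      using running_max_mono[of "Suc k" N Y x] True that by (auto simp: max_def)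
    then have "(\<Sum>k<N. indicat_real {y. running_max Y k y \<le> l} x * max 0 (running_max Y (Suc k) x - l)) = 0"
      by (intro sum.neutral) blast
    then show ?thesis using True assms(1)[of "Suc N"] assms(2) by (auto simp: max_def)
  next
    case False
    then show ?thesis using Suc by simp
  qed
qed

text \<open>
  A pathwise form of Doob's \<open>L\<^sub>2\<close> argument: \<open>m = min W l\<close> grows only when \<open>Y\<close> is at least \<open>m\<close>, so
  the increment of \<open>m\<^sup>2\<close> is at most \<open>2 Y\<close> times that of \<open>m\<close>, and summation by parts leaves a
  martingale transform of \<open>Y\<close> with the bounded predictable integrand \<open>m\<close>.
\<close>

lemma truncated_running_max_sq_le:
  assumes "\<And>k. 0 \<le> Y k x" "0 \<le> l"
  shows "(min (running_max Y N x) l)\<^sup>2 \<le> 2 * (Y N x * min (running_max Y N x) l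
           - (\<Sum>k<N. min (running_max Y k x) l * (Y (Suc k) x - Y k x)))"
proof (induction N)
  case 0
  have "(min (Y 0 x) l)\<^sup>2 \<le> Y 0 x * min (Y 0 x) l"
    unfolding power2_eq_square using assms(1)[of 0] assms(2) by (intro mult_right_mono) auto
  moreover have "0 \<le> Y 0 x * min (Y 0 x) l" using assms(1)[of 0] assms(2) by auto
  ultimately show ?case by simp
next
  case (Suc N)
  define m where "m = min (running_max Y N x) l"
  define m' where "m' = min (running_max Y (Suc N) x) l"
  have m: "0 \<le> m" "m \<le> m'"
    using running_max_nonneg[of Y x N] assms unfolding m_def m'_def by auto
  have "m' \<le> Y (Suc N) x \<or> m' = m" unfolding m_def m'_def by (auto simp: max_def min_def)
  then have "m'\<^sup>2 - m\<^sup>2 \<le> 2 * Y (Suc N) x * (m' - m)"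
  proof
    assume "m' \<le> Y (Suc N) x"
    then have "(m' + m) * (m' - m) \<le> (2 * Y (Suc N) x) * (m' - m)"
      using m by (intro mult_right_mono) auto
    then show ?thesis by (simp add: algebra_simps power2_eq_square)
  qed auto
  then show ?case using Suc unfolding m_def[symmetric] m'_def[symmetric] sum.lessThan_Suc
    by (simp add: algebra_simps)
qed

lemma norm_diff_sq_expand:
  fixes a b :: complex
  shows "(norm (b - a))\<^sup>2 + 2 * Re (cnj a * (b - a)) = (norm b)\<^sup>2 - (norm a)\<^sup>2"
  by (simp only: cmod_power2) (simp add: power2_eq_square algebra_simps)

text \<open>
  Expanding \<open>|f|\<^sup>2\<close> step by step, the squared increments and the linear terms up to the last time
  before passage add up to at most \<open>|f|\<^sup>2\<close> at that time, hence to at most \<open>l Y\<close>. The passage from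
  \<open>a\<close> to \<open>b\<close> contributes only its linear term \<open>2 Re (cnj a (b - a))\<close>, since its squared increment
  is excluded; added to \<open>|a|\<^sup>2\<close>, it gives at most \<open>2 |a| |b|\<close>, where \<open>|a| \<le> l\<close> and \<open>|b|\<close> is at most
  the value at which \<open>Y\<close> is stopped. The linear terms form a martingale transform and vanish in
  expectation.
\<close>

lemma sum_sq_diff_below_le:
  fixes f :: "nat \<Rightarrow> 'a \<Rightarrow> complex"
  assumes f: "\<And>k. norm (f k x) \<le> Y k x" and l: "0 \<le> l"
  shows "(\<Sum>k<N. indicat_real {y. running_max Y (Suc k) y \<le> l} x * (norm (f (Suc k) x - f k x))\<^sup>2)
    + 2 * (\<Sum>k<N. indicat_real {y. running_max Y k y \<le> l} x * Re (cnj (f k x) * (f (Suc k) x - f k x)))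
    \<le> 2 * l * stopped_above l Y N x"
proof -
  have Y: "0 \<le> Y k x" for k using f[of k] norm_ge_zero[of "f k x"] by linarith
  have "(\<Sum>k<N. indicat_real {y. running_max Y (Suc k) y \<le> l} x * (norm (f (Suc k) x - f k x))\<^sup>2)
    + 2 * (\<Sum>k<N. indicat_real {y. running_max Y k y \<le> l} x * Re (cnj (f k x) * (f (Suc k) x - f k x)))
    \<le> (if running_max Y N x \<le> l then (norm (f N x))\<^sup>2 else 2 * l * stopped_above l Y N x)"
  proof (induction N)
    case 0
    then show ?case using l Y by simp
  next
    case (Suc N)
    consider "running_max Y (Suc N) x \<le> l" | "running_max Y N x \<le> l" "l < running_max Y (Suc N) x"
      | "l < running_max Y N x" by linarith
    then show ?case
    proof cases
      case 1
      then have 2: "running_max Y N x \<le> l" using running_max_le_Suc[of Y N x] by linarith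
      have e: "indicat_real {y. running_max Y (Suc N) y \<le> l} x = 1"
          "indicat_real {y. running_max Y N y \<le> l} x = 1" using 1 2 by (simp_all add: indicator_def)
      show ?thesis using Suc norm_diff_sq_expand[of "f (Suc N) x" "f N x"]
        by (simp only: sum.lessThan_Suc e 1 2 if_True mult_1 distrib_left)
    next
      case 2
      have "2 * Re (cnj (f N x) * (f (Suc N) x - f N x))
          = 2 * Re (cnj (f N x) * f (Suc N) x) - 2 * (norm (f N x))\<^sup>2"
        by (simp only: cmod_power2) (simp add: power2_eq_square algebra_simps)
      also have "Re (cnj (f N x) * f (Suc N) x) \<le> norm (f N x) * norm (f (Suc N) x)"
        using complex_Re_le_cmod[of "cnj (f N x) * f (Suc N) x"] by (simp add: norm_mult)
      also have "norm (f N x) * norm (f (Suc N) x) \<le> l * Y (Suc N) x"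
        using f[of N] f[of "Suc N"] le_running_max[of Y N x] 2 l by (intro mult_mono) auto
      finally have "2 * Re (cnj (f N x) * (f (Suc N) x - f N x)) + (norm (f N x))\<^sup>2
          \<le> 2 * l * Y (Suc N) x" using zero_le_power2[of "norm (f N x)"] by linarith
      moreover have e: "indicat_real {y. running_max Y (Suc N) y \<le> l} x = 0"
          "indicat_real {y. running_max Y N y \<le> l} x = 1" "\<not> running_max Y (Suc N) x \<le> l"
        using 2 by (simp_all add: indicator_def del: running_max.simps)
      ultimately show ?thesis using Suc
        by (simp only: sum.lessThan_Suc stopped_above.simps e 2 if_True if_False mult_1 mult_zero_left
            distrib_left)
    next
      case 3
      then have "l < running_max Y (Suc N) x" using running_max_le_Suc[of Y N x] by linarith
      then have e: "indicat_real {y. running_max Y (Suc N) y \<le> l} x = 0"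
          "indicat_real {y. running_max Y N y \<le> l} x = 0" "\<not> running_max Y (Suc N) x \<le> l"
          "\<not> running_max Y N x \<le> l"
        using 3 by (simp_all add: indicator_def del: running_max.simps)
      show ?thesis using Suc
        by (simp only: sum.lessThan_Suc stopped_above.simps e if_False mult_zero_left
            distrib_left)
    qed
  qed
  also have "\<dots> \<le> 2 * l * stopped_above l Y N x"
  proof (cases "running_max Y N x \<le> l")
    case True
    have "(norm (f N x))\<^sup>2 \<le> l * Y N x" unfolding power2_eq_square
      using f[of N] le_running_max[of Y N x] True l by (intro mult_mono) auto
    then show ?thesis using True mult_nonneg_nonneg[OF l Y[of N]] stopped_above_before[OF True] by simp
  qed simp
  finally show ?thesis .
qed

text \<open>
  With \<open>W = W\<^sub>n\<close> and \<open>Y = Y\<^bsub>n+1\<^esub> > 2W\<close>, the increment is at most \<open>Y + W\<close>, which is at most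
  \<open>3 (Y - W)\<close> because \<open>4 W \<le> 2 Y\<close>.
\<close>

lemma norm_diff_le_increment_running_max:
  fixes f :: "nat \<Rightarrow> 'a \<Rightarrow> complex"
  assumes f: "\<And>k. norm (f k x) \<le> Y k x" and big: "2 * running_max Y n x < Y (Suc n) x"
  shows "norm (f (Suc n) x - f n x) \<le> 3 * (running_max Y (Suc n) x - running_max Y n x)"
proof -
  have "norm (f (Suc n) x - f n x) \<le> Y (Suc n) x + running_max Y n x"
    using norm_triangle_ineq4[of "f (Suc n) x" "f n x"] f[of n] f[of "Suc n"]
      le_running_max[of Y n x] by linarith
  moreover have "0 \<le> running_max Y n x"
    using f[of n] norm_ge_zero[of "f n x"] le_running_max[of Y n x] by linarith
  ultimately show ?thesis using big by simp
qed

section \<open>Compensators along a filtration\<close>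

lemma indicator_set_measurable [measurable (raw)]:
  assumes "Measurable.pred N P"
  shows "indicat_real {y. P y} \<in> borel_measurable N"
proof -
  have "(\<lambda>x. if P x then 1 else 0 :: real) \<in> borel_measurable N" using assms by measurable
  moreover have "(\<lambda>x. if P x then 1 else 0 :: real) = indicat_real {y. P y}"
    by (auto simp: indicator_def)
  ultimately show ?thesis by simp
qed

lemma integrable_bounded_mult:
  fixes g :: "'a \<Rightarrow> real"
  assumes [measurable]: "\<phi> \<in> borel_measurable M" and "\<And>x. \<bar>\<phi> x\<bar> \<le> C" and g: "integrable M g"
  shows "integrable M (\<lambda>x. \<phi> x * g x)"
proof (rule Bochner_Integration.integrable_bound)
  show "integrable M (\<lambda>x. C * g x)" using g by simp
  show "(\<lambda>x. \<phi> x * g x) \<in> borel_measurable M" using borel_measurable_integrable[OF g] by measurable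
  have "0 \<le> C" using assms(2) abs_ge_zero order_trans by blast
  then show "AE x in M. norm (\<phi> x * g x) \<le> norm (C * g x)"
    using assms(2) by (auto simp: abs_mult intro!: mult_right_mono)
qed

lemma (in prob_space) prob_le_integral:
  assumes "integrable M u" "AE x in M. 0 \<le> u x" "AE x in M. x \<in> S \<longrightarrow> 1 \<le> u x"
    and [measurable]: "S \<in> sets M"
  shows "prob S \<le> (\<integral>x. u x \<partial>M)"
proof -
  have "prob S = (\<integral>x. indicat_real S x \<partial>M)" by simp
  also have "\<dots> \<le> (\<integral>x. u x \<partial>M)"
    by (rule integral_mono_AE') (use assms in \<open>auto simp: indicator_def\<close>)
  finally show ?thesis .
qed

locale filtered_prob_space = prob_space M for M :: "'a measure" +
  fixes F :: "nat \<Rightarrow> 'a measure"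
  assumes filtration: "filtration (space M) F"
    and subalgebra_F: "subalgebra M (F n)"
begin

sublocale E: sigma_finite_subalgebra M "F n" for n
  by (rule finite_measure_subalgebra_is_sigma_finite)
     (simp add: finite_measure_subalgebra_def finite_measure_subalgebra_axioms_def subalgebra_F
        finite_measure_axioms)

lemma subalgebra_F_mono: "n \<le> m \<Longrightarrow> subalgebra (F m) (F n)"
  using filtration by (simp add: subalgebra_def filtration_def)

lemma measurable_F_mono: "f \<in> measurable (F n) N \<Longrightarrow> n \<le> m \<Longrightarrow> f \<in> measurable (F m) N"
  using measurable_from_subalg[OF subalgebra_F_mono] by blast

lemma measurable_F_M: "f \<in> measurable (F n) N \<Longrightarrow> f \<in> measurable M N"
  using measurable_from_subalg[OF subalgebra_F] by blast

lemma integral_mult_cond_exp_diff: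
  assumes \<phi>: "\<phi> \<in> borel_measurable (F n)" "\<And>x. \<bar>\<phi> x\<bar> \<le> C"
    and int: "integrable M p" "integrable M q"
    and cond: "AE x in M. real_cond_exp M (F n) q x = p x"
  shows "integrable M (\<lambda>x. \<phi> x * (q x - p x))"
    and "(\<integral>x. \<phi> x * (q x - p x) \<partial>M) = 0"
proof -
  note [measurable] = measurable_F_M[OF \<phi>(1)] borel_measurable_integrable[OF int(1)]
    borel_measurable_integrable[OF int(2)]
  have i: "integrable M (\<lambda>x. \<phi> x * p x)" "integrable M (\<lambda>x. \<phi> x * q x)"
    by (rule integrable_bounded_mult[OF _ \<phi>(2)]; simp add: int)+
  have "(\<integral>x. \<phi> x * q x \<partial>M) = (\<integral>x. \<phi> x * real_cond_exp M (F n) q x \<partial>M)"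
    by (rule E.real_cond_exp_intg(2)[symmetric, OF i(2) \<phi>(1)]) simp
  also have "\<dots> = (\<integral>x. \<phi> x * p x \<partial>M)"
    by (rule integral_cong_AE) (use cond in auto)
  finally show "(\<integral>x. \<phi> x * (q x - p x) \<partial>M) = 0"
    using i by (simp add: right_diff_distrib)
  show "integrable M (\<lambda>x. \<phi> x * (q x - p x))"
    using i by (simp add: right_diff_distrib)
qed

text \<open>
  The case \<open>p = 2\<close> of Garsia's inequality for compensators. With \<open>A\<close> the compensator and \<open>Z\<close> the
  sum of the \<open>u\<^sub>k\<close>, one has \<open>A\<^sup>2 \<le> 2 \<Sum> p\<^sub>k A\<^bsub>k+1\<^esub>\<close> with \<open>p\<^sub>k = E\<^sub>k u\<^sub>k\<close>. Since \<open>A\<close> is predictable, \<open>p\<^sub>k\<close> can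
  be replaced by \<open>u\<^sub>k\<close> under the integral, and \<open>A\<close> is increasing, so \<open>E A\<^sup>2 \<le> 2 E(A Z)\<close>;
  half of \<open>E A\<^sup>2\<close> is then absorbed by means of \<open>2 A Z \<le> A\<^sup>2 / 2 + 2 Z\<^sup>2\<close>.
\<close>

lemma integral_sq_sum_cond_exp_le:
  assumes u [measurable]: "\<And>k. u k \<in> borel_measurable M"
    and bounds: "\<And>k x. 0 \<le> u k x" "\<And>k x. u k x \<le> C"
  shows "integrable M (\<lambda>x. (\<Sum>k<N. real_cond_exp M (F k) (u k) x)\<^sup>2)"
    and "(\<integral>x. (\<Sum>k<N. real_cond_exp M (F k) (u k) x)\<^sup>2 \<partial>M) \<le> 4 * (\<integral>x. (\<Sum>k<N. u k x)\<^sup>2 \<partial>M)"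
proof -
  define p where "p k = real_cond_exp M (F k) (u k)" for k
  define A where "A n x = (\<Sum>k<n. p k x)" for n x
  define Z where "Z x = (\<Sum>k<N. u k x)" for x
  have C: "0 \<le> C" using bounds order_trans by blast
  have int_u: "integrable M (u k)" for k
    by (rule integrable_const_bound[of _ C]) (use bounds in auto)
  have p_meas [measurable]: "p k \<in> borel_measurable M" for k unfolding p_def by simp
  have pF: "p k \<in> borel_measurable (F k)" for k unfolding p_def by simp
  have A_meas [measurable]: "A n \<in> borel_measurable M" for n unfolding A_def by simp
  have Z_meas [measurable]: "Z \<in> borel_measurable M" unfolding Z_def by simp
  have AF: "A (Suc k) \<in> borel_measurable (F k)" for k
    unfolding A_def by (intro borel_measurable_sum measurable_F_mono[OF pF]) auto
  have p_bd: "AE x in M. \<forall>k. 0 \<le> p k x \<and> p k x \<le> C"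
  proof (subst AE_all_countable, intro allI)
    fix k show "AE x in M. 0 \<le> p k x \<and> p k x \<le> C"
      using E.real_cond_exp_ge_c[OF int_u, of 0 k k] E.real_cond_exp_le_c[OF int_u, of k C k] bounds
      unfolding p_def by auto
  qed
  have A_bd: "AE x in M. \<forall>n. 0 \<le> A n x \<and> A n x \<le> real n * C"
    using p_bd
  proof eventually_elim
    case (elim x)
    have "A n x \<le> real (card {..<n}) * C" for n unfolding A_def
      by (rule sum_bounded_above) (use elim in auto)
    then show ?case unfolding A_def using elim by (auto intro: sum_nonneg)
  qed
  have Z_bd: "0 \<le> Z x \<and> Z x \<le> real N * C" for x
    using sum_bounded_above[of "{..<N}" "\<lambda>k. u k x" C] bounds unfolding Z_def by (auto intro: sum_nonneg)
  have int_AA: "integrable M (\<lambda>x. (A N x)\<^sup>2)"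
    by (rule integrable_const_bound[of _ "(real N * C)\<^sup>2"])
       (use A_bd in eventually_elim, auto intro: power_mono)
  have int_ZZ: "integrable M (\<lambda>x. (Z x)\<^sup>2)"
    by (rule integrable_const_bound[of _ "(real N * C)\<^sup>2"]) (use Z_bd in \<open>auto intro: power_mono\<close>)
  have int_uA: "integrable M (\<lambda>x. A (Suc k) x * u k x)" for k
    by (rule integrable_const_bound[of _ "(real (Suc k) * C) * C"])
       (use A_bd in eventually_elim, use bounds C in \<open>auto simp: abs_mult simp del: of_nat_Suc intro!: mult_mono\<close>)
  have intg: "integrable M (\<lambda>x. A (Suc k) x * p k x)"
     "(\<integral>x. A (Suc k) x * p k x \<partial>M) = (\<integral>x. A (Suc k) x * u k x \<partial>M)" for k
    unfolding p_def by (rule E.real_cond_exp_intg[OF int_uA AF u])+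
  have "(A n x)\<^sup>2 \<le> 2 * (\<Sum>k<n. A (Suc k) x * p k x)" for n x
  proof (induction n)
    case (Suc n)
    have "(A (Suc n) x)\<^sup>2 = (A n x)\<^sup>2 + 2 * (A (Suc n) x * p n x) - (p n x)\<^sup>2"
      unfolding A_def by (simp add: power2_eq_square algebra_simps)
    with Suc show ?case using zero_le_power2[of "p n x"]
      unfolding sum.lessThan_Suc distrib_left by linarith
  qed (simp add: A_def)
  then have "(\<integral>x. (A N x)\<^sup>2 \<partial>M) \<le> (\<integral>x. 2 * (\<Sum>k<N. A (Suc k) x * p k x) \<partial>M)"
    by (intro integral_mono int_AA) (auto intro: intg)
  also have "\<dots> = 2 * (\<Sum>k<N. \<integral>x. A (Suc k) x * p k x \<partial>M)"
    by (simp add: Bochner_Integration.integral_sum intg(1))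
  also have "\<dots> = (\<integral>x. 2 * (\<Sum>k<N. A (Suc k) x * u k x) \<partial>M)"
    by (simp add: Bochner_Integration.integral_sum intg(2) int_uA)
  also have "\<dots> \<le> (\<integral>x. (A N x)\<^sup>2 / 2 + 2 * (Z x)\<^sup>2 \<partial>M)"
  proof (rule integral_mono_AE)
    show "AE x in M. 2 * (\<Sum>k<N. A (Suc k) x * u k x) \<le> (A N x)\<^sup>2 / 2 + 2 * (Z x)\<^sup>2"
      using p_bd
    proof eventually_elim
      case (elim x)
      have "A (Suc k) x \<le> A N x" if "k < N" for k
        unfolding A_def by (rule sum_mono2) (use that elim in auto)
      then have "(\<Sum>k<N. A (Suc k) x * u k x) \<le> (\<Sum>k<N. A N x * u k x)"
        using bounds by (intro sum_mono mult_right_mono) auto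
      also have "\<dots> = A N x * Z x" by (simp add: Z_def sum_distrib_left)
      finally have "2 * (\<Sum>k<N. A (Suc k) x * u k x) \<le> 2 * (A N x * Z x)" by simp
      also have "\<dots> \<le> (A N x)\<^sup>2 / 2 + 2 * (Z x)\<^sup>2"
        using zero_le_power2[of "A N x / 2 - Z x"] by (simp add: power2_eq_square field_simps)
      finally show ?case .
    qed
  qed (use int_AA int_ZZ int_uA in auto)
  also have "\<dots> = (\<integral>x. (A N x)\<^sup>2 \<partial>M) / 2 + 2 * (\<integral>x. (Z x)\<^sup>2 \<partial>M)"
    using int_AA int_ZZ by simp
  finally show "(\<integral>x. (\<Sum>k<N. real_cond_exp M (F k) (u k) x)\<^sup>2 \<partial>M) \<le> 4 * (\<integral>x. (\<Sum>k<N. u k x)\<^sup>2 \<partial>M)"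
    unfolding A_def p_def Z_def by simp
  show "integrable M (\<lambda>x. (\<Sum>k<N. real_cond_exp M (F k) (u k) x)\<^sup>2)"
    using int_AA unfolding A_def p_def .
qed

end

section \<open>Weak type bounds for a non-negative martingale\<close>

locale nonneg_martingale = filtered_prob_space M F for M :: "'a measure" and F +
  fixes Y :: "nat \<Rightarrow> 'a \<Rightarrow> real"
  assumes adapted_Y: "Y n \<in> borel_measurable (F n)"
    and integrable_Y: "integrable M (Y n)"
    and Y_nonneg: "0 \<le> Y n x"
    and cond_exp_Y: "AE x in M. real_cond_exp M (F n) (Y (Suc n)) x = Y n x"
begin

lemma Y_measurable [measurable]: "Y n \<in> borel_measurable M"
  by (rule measurable_F_M[OF adapted_Y])

lemma integral_mult_increment:
  assumes "\<phi> \<in> borel_measurable (F n)" "\<And>x. \<bar>\<phi> x\<bar> \<le> C"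
  shows "integrable M (\<lambda>x. \<phi> x * (Y (Suc n) x - Y n x))"
    and "(\<integral>x. \<phi> x * (Y (Suc n) x - Y n x) \<partial>M) = 0"
  by (rule integral_mult_cond_exp_diff[OF assms integrable_Y integrable_Y cond_exp_Y])+

lemma expectation_Y: "expectation (Y n) = expectation (Y 0)"
proof (induction n)
  case (Suc n)
  have "(\<integral>x. 1 * (Y (Suc n) x - Y n x) \<partial>M) = 0" by (rule integral_mult_increment(2)[of _ _ 1]) auto
  then show ?case using Suc integrable_Y by simp
qed simp

lemma adapted_running_max: "running_max Y n \<in> borel_measurable (F n)"
proof (induction n)
  case (Suc n)
  have [measurable]: "running_max Y n \<in> borel_measurable (F (Suc n))"
    "Y (Suc n) \<in> borel_measurable (F (Suc n))"
    using measurable_F_mono[OF Suc] adapted_Y by auto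
  show ?case by (simp add: running_max.simps(2)[abs_def])
qed (use adapted_Y in \<open>simp add: running_max.simps(1)[abs_def]\<close>)

lemma running_max_measurable [measurable]: "running_max Y n \<in> borel_measurable M"
  by (rule measurable_F_M[OF adapted_running_max])

lemma integrable_running_max: "integrable M (running_max Y n)"
proof (rule Bochner_Integration.integrable_bound)
  show "integrable M (\<lambda>x. \<Sum>k\<le>n. Y k x)" using integrable_Y by simp
  show "AE x in M. norm (running_max Y n x) \<le> norm (\<Sum>k\<le>n. Y k x)"
    using running_max_le_sum[of Y _ n] running_max_nonneg[of Y _ n] Y_nonneg by (auto simp: sum_nonneg)
qed simp

lemma indicator_below_measurable: "indicat_real {y. running_max Y n y \<le> l} \<in> borel_measurable (F n)"
  using adapted_running_max by measurable

text \<open>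
  Optional stopping: the stopped process only takes steps \<open>Y\<^bsub>n+1\<^esub> - Y\<^sub>n\<close> on the event
  \<open>W\<^sub>n \<le> l\<close>, which belongs to \<open>F\<^sub>n\<close>.
\<close>

lemma stopped_above_martingale:
  shows integrable_stopped_above: "integrable M (stopped_above l Y n)"
    and expectation_stopped_above: "expectation (stopped_above l Y n) = expectation (Y 0)"
proof -
  have "integrable M (stopped_above l Y n) \<and> expectation (stopped_above l Y n) = expectation (Y 0)"
  proof (induction n)
    case 0
    then show ?case using integrable_Y by (simp add: stopped_above.simps(1)[abs_def])
  next
    case (Suc n)
    have eq: "stopped_above l Y (Suc n) = (\<lambda>x. stopped_above l Y n x +
        indicat_real {y. running_max Y n y \<le> l} x * (Y (Suc n) x - Y n x))"
      using stopped_above_Suc_diff[of l Y n] by blast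
    show ?case unfolding eq
      using Suc integral_mult_increment[OF indicator_below_measurable[of n l], of 1] by simp
  qed
  then show "integrable M (stopped_above l Y n)"
    "expectation (stopped_above l Y n) = expectation (Y 0)" by auto
qed

lemma stopped_above_measurable [measurable]: "stopped_above l Y n \<in> borel_measurable M"
  using integrable_stopped_above by blast

lemma integral_truncated_running_max_sq_le:
  assumes l: "0 \<le> l"
  shows "(\<integral>x. (min (running_max Y N x) l)\<^sup>2 \<partial>M) \<le> 2 * l * expectation (Y 0)"
proof -
  have W: "0 \<le> running_max Y n x" for n x by (rule running_max_nonneg) (rule Y_nonneg)
  have bd: "\<bar>min (running_max Y k x) l\<bar> \<le> l" for k x using W l by auto
  have mF: "(\<lambda>x. min (running_max Y k x) l) \<in> borel_measurable (F k)" for k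
    using adapted_running_max[of k] by simp
  note inc = integral_mult_increment[OF mF bd]
  have i: "integrable M (\<lambda>x. Y N x * min (running_max Y N x) l)"
    by (subst mult.commute) (rule integrable_bounded_mult[OF _ bd integrable_Y], simp)
  have "(\<integral>x. (min (running_max Y N x) l)\<^sup>2 \<partial>M) \<le> (\<integral>x. 2 * (Y N x * min (running_max Y N x) l
           - (\<Sum>k<N. min (running_max Y k x) l * (Y (Suc k) x - Y k x))) \<partial>M)"
  proof (rule integral_mono)
    show "integrable M (\<lambda>x. (min (running_max Y N x) l)\<^sup>2)"
      by (rule integrable_const_bound[of _ "l\<^sup>2"]) (use W l in \<open>auto intro: power_mono\<close>)
    show "(min (running_max Y N x) l)\<^sup>2 \<le> 2 * (Y N x * min (running_max Y N x) l
           - (\<Sum>k<N. min (running_max Y k x) l * (Y (Suc k) x - Y k x)))" for x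
      using Y_nonneg l by (intro truncated_running_max_sq_le) auto
  qed (use i inc(1) in auto)
  also have "\<dots> = 2 * (\<integral>x. Y N x * min (running_max Y N x) l \<partial>M)"
    using i inc by (simp add: Bochner_Integration.integral_sum del: right_diff_distrib)
  also have "(\<integral>x. Y N x * min (running_max Y N x) l \<partial>M) \<le> (\<integral>x. l * Y N x \<partial>M)"
    by (intro integral_mono i) (use integrable_Y Y_nonneg W l in \<open>auto simp: mult.commute[of l] intro: mult_left_mono\<close>)
  also have "\<dots> = l * expectation (Y 0)" using expectation_Y by simp
  finally show ?thesis by simp
qed

text \<open>
  On the event \<open>W\<^sub>N \<le> l\<close> the compensator of \<open>W\<close> is the sum of \<open>A\<close>, the compensator of \<open>min W l\<close>, and
  \<open>B\<close>, that of the overshoot above \<open>l\<close>. The former is controlled in \<open>L\<^sub>2\<close> by \<open>l E Y\<^sub>0\<close> and the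
  latter in \<open>L\<^sub>1\<close> by \<open>E Y\<^sub>0\<close>, while the event \<open>W\<^sub>N > l\<close> is controlled by the process stopped
  above \<open>l\<close>. All three bounds enter through one pointwise majorant of the indicator function.
\<close>

lemma prob_running_max_plus_compensator:
  assumes t: "0 < t"
  shows "prob {x \<in> space M. t < running_max Y N x
      + (\<Sum>k<N. real_cond_exp M (F k) (\<lambda>y. running_max Y (Suc k) y - running_max Y k y) x)}
    \<le> 70 * expectation (Y 0) / t"
proof -
  \<comment> \<open>If the sum exceeds \<open>t\<close>, then the maximum or its compensator exceeds \<open>t / 2\<close>.\<close>
  define l where "l = t / 2"
  have l: "0 < l" using t by (simp add: l_def)
  define W where "W = running_max Y"
  define I where "I k = indicat_real {y. W k y \<le> l}" for k
  define m where "m k x = min (W k x) l" for k x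
  define u where "u k x = m (Suc k) x - m k x" for k x
  define e where "e k x = I k x * max 0 (W (Suc k) x - l)" for k x
  define v where "v k = real_cond_exp M (F k) (\<lambda>y. W (Suc k) y - W k y)" for k
  define A where "A x = (\<Sum>k<N. real_cond_exp M (F k) (u k) x)" for x
  define B where "B x = (\<Sum>k<N. real_cond_exp M (F k) (e k) x)" for x
  define X where "X = stopped_above l Y N"
  have [measurable]: "W k \<in> borel_measurable M" for k by (simp add: W_def)
  have [measurable]: "I k \<in> borel_measurable M" for k by (simp add: I_def)
  have [measurable]: "m k \<in> borel_measurable M" for k unfolding m_def[abs_def] by simp
  have [measurable]: "u k \<in> borel_measurable M" for k unfolding u_def[abs_def] by simp
  have IF: "I k \<in> borel_measurable (F k)" for k
    unfolding I_def W_def by (rule indicator_below_measurable)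
  have W0: "0 \<le> W k x" for k x unfolding W_def by (rule running_max_nonneg) (rule Y_nonneg)
  have W_mono: "W k x \<le> W (Suc k) x" for k x unfolding W_def by (rule running_max_le_Suc)
  have int_W: "integrable M (W k)" for k unfolding W_def by (rule integrable_running_max)
  have u_bd: "0 \<le> u k x" "u k x \<le> l" for k x
    using W_mono[of k x] W0[of k x] l by (auto simp: u_def m_def)
  have int_u: "integrable M (u k)" for k
    by (rule integrable_const_bound[of _ l]) (use u_bd in auto)
  have int_e: "integrable M (e k)" for k
  proof (rule Bochner_Integration.integrable_bound[OF int_W[of "Suc k"]])
    show "AE x in M. norm (e k x) \<le> norm (W (Suc k) x)"
      using W0 l by (auto simp: e_def I_def indicator_def)
    show "e k \<in> borel_measurable M" unfolding e_def[abs_def] by simp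
  qed
  have split: "I k x * (W (Suc k) x - W k x) = u k x + e k x" for k x
    using W_mono[of k x] by (auto simp: u_def m_def e_def I_def indicator_def)
  have cond: "AE x in M. I k x * v k x = real_cond_exp M (F k) (u k) x + real_cond_exp M (F k) (e k) x" for k
  proof -
    have "AE x in M. real_cond_exp M (F k) (\<lambda>x. I k x * (W (Suc k) x - W k x)) x = I k x * v k x"
      unfolding v_def
      by (rule E.real_cond_exp_mult[OF IF])
         (use int_W in \<open>auto intro!: integrable_bounded_mult[of _ _ 1] simp: I_def\<close>)
    with E.real_cond_exp_add[OF int_u int_e, of k k k] show ?thesis
      unfolding split by eventually_elim simp
  qed
  have e_nonneg: "AE x in M. 0 \<le> real_cond_exp M (F k) (e k) x" for k
    by (rule E.real_cond_exp_pos) (use int_e in \<open>auto simp: e_def I_def\<close>)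
  have B_nonneg: "AE x in M. 0 \<le> B x"
  proof -
    have "AE x in M. \<forall>k. 0 \<le> real_cond_exp M (F k) (e k) x"
      by (subst AE_all_countable) (use e_nonneg in blast)
    then show ?thesis by eventually_elim (auto simp: B_def intro: sum_nonneg)
  qed
  have int_B: "integrable M B" unfolding B_def[abs_def] using E.real_cond_exp_int(1)[OF int_e] by simp
  have "expectation B = (\<Sum>k<N. expectation (e k))"
    unfolding B_def[abs_def] using E.real_cond_exp_int[OF int_e] by (simp add: Bochner_Integration.integral_sum)
  also have "\<dots> = (\<integral>x. (\<Sum>k<N. e k x) \<partial>M)"
    using int_e by (simp add: Bochner_Integration.integral_sum)
  also have "\<dots> \<le> (\<integral>x. X x \<partial>M)"
  proof (rule integral_mono)
    show "(\<Sum>k<N. e k x) \<le> X x" for x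
      unfolding X_def e_def I_def W_def using Y_nonneg l by (intro sum_overshoot_le_stopped_above) auto
  qed (use int_e in \<open>auto simp: X_def integrable_stopped_above\<close>)
  finally have EB: "expectation B \<le> expectation (Y 0)" by (simp add: X_def expectation_stopped_above)
  have int_A: "integrable M (\<lambda>x. (A x)\<^sup>2)"
    unfolding A_def by (rule integral_sq_sum_cond_exp_le(1)[OF _ u_bd]) simp
  have "(\<integral>x. (A x)\<^sup>2 \<partial>M) \<le> 4 * (\<integral>x. (\<Sum>k<N. u k x)\<^sup>2 \<partial>M)"
    unfolding A_def by (rule integral_sq_sum_cond_exp_le(2)[OF _ u_bd]) simp
  also have "(\<integral>x. (\<Sum>k<N. u k x)\<^sup>2 \<partial>M) \<le> (\<integral>x. (m N x)\<^sup>2 \<partial>M)"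
  proof (rule integral_mono_AE')
    show "integrable M (\<lambda>x. (m N x)\<^sup>2)"
      by (rule integrable_const_bound[of _ "l\<^sup>2"]) (use W0 l in \<open>auto simp: m_def intro: power_mono\<close>)
    have "(\<Sum>k<N. u k x) = m N x - m 0 x" for x
      unfolding u_def by (rule sum_lessThan_telescope)
    moreover have "0 \<le> m 0 x" for x using W0 l by (simp add: m_def)
    moreover have "0 \<le> (\<Sum>k<N. u k x)" for x using u_bd by (intro sum_nonneg)
    ultimately have "0 \<le> (\<Sum>k<N. u k x) \<and> (\<Sum>k<N. u k x) \<le> m N x" for x
      by (metis diff_le_eq le_add_same_cancel1)
    then show "AE x in M. (\<Sum>k<N. u k x)\<^sup>2 \<le> (m N x)\<^sup>2" by (auto intro: power_mono)
  qed simp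
  also have "(\<integral>x. (m N x)\<^sup>2 \<partial>M) \<le> 2 * l * expectation (Y 0)"
    unfolding m_def W_def using l by (intro integral_truncated_running_max_sq_le) simp
  finally have EA: "(\<integral>x. (A x)\<^sup>2 \<partial>M) \<le> 8 * l * expectation (Y 0)" by simp
  have int_X: "integrable M X" unfolding X_def by (rule integrable_stopped_above)
  have X0: "0 \<le> X x" for x unfolding X_def by (rule stopped_above_nonneg) (rule Y_nonneg)
  have "prob {x \<in> space M. t < W N x + (\<Sum>k<N. v k x)}
      \<le> (\<integral>x. X x / l + 4 * (A x)\<^sup>2 / l\<^sup>2 + 2 * B x / l \<partial>M)"
  proof (rule prob_le_integral)
    show "integrable M (\<lambda>x. X x / l + 4 * (A x)\<^sup>2 / l\<^sup>2 + 2 * B x / l)"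
      using int_X int_A int_B by simp
    show "AE x in M. 0 \<le> X x / l + 4 * (A x)\<^sup>2 / l\<^sup>2 + 2 * B x / l"
      using B_nonneg X0 l by auto
    have "AE x in M. \<forall>k. I k x * v k x = real_cond_exp M (F k) (u k) x + real_cond_exp M (F k) (e k) x"
      by (subst AE_all_countable) (use cond in blast)
    then show "AE x in M. x \<in> {x \<in> space M. t < W N x + (\<Sum>k<N. v k x)} \<longrightarrow>
        1 \<le> X x / l + 4 * (A x)\<^sup>2 / l\<^sup>2 + 2 * B x / l"
      using B_nonneg
    proof eventually_elim
      case (elim x)
      have nn: "0 \<le> X x / l" "0 \<le> 4 * (A x)\<^sup>2 / l\<^sup>2" "0 \<le> 2 * B x / l" using X0 l elim by auto
      show ?case
      proof (intro impI)
        assume "x \<in> {x \<in> space M. t < W N x + (\<Sum>k<N. v k x)}"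
        then have t: "t < W N x + (\<Sum>k<N. v k x)" by simp
        show "1 \<le> X x / l + 4 * (A x)\<^sup>2 / l\<^sup>2 + 2 * B x / l"
        proof (cases "l < W N x")
          case True
          then have "l < X x" unfolding X_def W_def by (rule stopped_above_after)
          then have "1 \<le> X x / l" using l by simp
          with nn show ?thesis by linarith
        next
          case False
          have "W k x \<le> l" if "k < N" for k
            using running_max_mono[of k N Y x] that False by (simp add: W_def)
          then have "(\<Sum>k<N. v k x) = (\<Sum>k<N. I k x * v k x)"
            by (intro sum.cong) (auto simp: I_def)
          also have "\<dots> = A x + B x" using elim by (simp add: A_def B_def sum.distrib)
          finally have "l < A x + B x" using t False by (simp add: l_def)
          then consider "l / 2 < A x" | "l / 2 < B x" by linarith
          then show ?thesis
          proof cases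
            case 1
            then have "(l / 2)\<^sup>2 \<le> (A x)\<^sup>2" using l by (intro power_mono) auto
            then have "1 \<le> 4 * (A x)\<^sup>2 / l\<^sup>2" using l by (simp add: field_simps)
            with nn show ?thesis by linarith
          next
            case 2
            then have "1 \<le> 2 * B x / l" using l by (simp add: field_simps)
            with nn show ?thesis by linarith
          qed
        qed
      qed
    qed
    show "{x \<in> space M. t < W N x + (\<Sum>k<N. v k x)} \<in> sets M" unfolding v_def by measurable
  qed
  also have "\<dots> = expectation X / l + 4 * (\<integral>x. (A x)\<^sup>2 \<partial>M) / l\<^sup>2 + 2 * expectation B / l"
    using int_X int_A int_B by simp
  also have "\<dots> \<le> expectation (Y 0) / l + 4 * (8 * l * expectation (Y 0)) / l\<^sup>2 + 2 * expectation (Y 0) / l"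
    using EA EB l by (intro add_mono divide_right_mono) (auto simp: X_def expectation_stopped_above)
  also have "\<dots> = 70 * expectation (Y 0) / t"
    using t by (simp add: l_def field_simps power2_eq_square)
  finally show ?thesis unfolding W_def v_def .
qed

end

section \<open>Complex martingales and their majorants\<close>

context filtered_prob_space
begin

lemma martingale_Re_Im:
  "martingale M F f \<longleftrightarrow> (\<forall>n. f n \<in> borel_measurable (F n) \<and> integrable M (f n) \<and>
     (AE x in M. real_cond_exp M (F n) (\<lambda>y. Re (f (Suc n) y)) x = Re (f n x)) \<and>
     (AE x in M. real_cond_exp M (F n) (\<lambda>y. Im (f (Suc n) y)) x = Im (f n x)))"
  unfolding martingale_def complex_cond_exp_def by (simp add: complex_eq_iff)

lemma martingale_diff:
  assumes f: "martingale M F f" and h: "martingale M F h"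
  shows "martingale M F (\<lambda>n x. f n x - h n x)"
  unfolding martingale_Re_Im
proof (intro allI conjI)
  fix n
  have [measurable]: "f n \<in> borel_measurable (F n)" "h n \<in> borel_measurable (F n)"
    and i: "integrable M (f n)" "integrable M (h n)" "integrable M (f (Suc n))" "integrable M (h (Suc n))"
    using f h by (auto simp: martingale_def)
  show "(\<lambda>x. f n x - h n x) \<in> borel_measurable (F n)" by simp
  show "integrable M (\<lambda>x. f n x - h n x)" using i by simp
  show "AE x in M. real_cond_exp M (F n) (\<lambda>y. Re (f (Suc n) y - h (Suc n) y)) x = Re (f n x - h n x)"
    using E.real_cond_exp_diff[OF integrable_Re[OF i(3)] integrable_Re[OF i(4)], of n]
      f[unfolded martingale_Re_Im, rule_format, THEN conjunct2, THEN conjunct2, THEN conjunct1, of n]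
      h[unfolded martingale_Re_Im, rule_format, THEN conjunct2, THEN conjunct2, THEN conjunct1, of n]
    unfolding minus_complex.sel by eventually_elim simp
  show "AE x in M. real_cond_exp M (F n) (\<lambda>y. Im (f (Suc n) y - h (Suc n) y)) x = Im (f n x - h n x)"
    using E.real_cond_exp_diff[OF integrable_Im[OF i(3)] integrable_Im[OF i(4)], of n]
      f[unfolded martingale_Re_Im, rule_format, THEN conjunct2, THEN conjunct2, THEN conjunct2, of n]
      h[unfolded martingale_Re_Im, rule_format, THEN conjunct2, THEN conjunct2, THEN conjunct2, of n]
    unfolding minus_complex.sel by eventually_elim simp
qed

lemma cond_exp_add_compensated:
  assumes p: "integrable M p" "p \<in> borel_measurable (F n)" and q: "integrable M q"
  shows "AE x in M. real_cond_exp M (F n) (\<lambda>y. p y + (q y - real_cond_exp M (F n) q y)) x = p x"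
proof -
  have i: "integrable M (real_cond_exp M (F n) q)" by (rule E.real_cond_exp_int(1)[OF q])
  show ?thesis
    using E.real_cond_exp_add[OF p(1) Bochner_Integration.integrable_diff[OF q i], of n]
      E.real_cond_exp_diff[OF q i, of n] E.real_cond_exp_F_meas[OF p]
      E.real_cond_exp_F_meas[OF i borel_measurable_cond_exp]
    by eventually_elim simp
qed

lemma complex_cond_exp_measurable: "complex_cond_exp M (F n) b \<in> borel_measurable (F n)"
  unfolding complex_cond_exp_def[abs_def] Complex_eq by measurable

lemma complex_cond_exp_measurable_M [measurable]: "complex_cond_exp M (F k) b \<in> borel_measurable M"
  by (rule measurable_F_M[OF complex_cond_exp_measurable])

lemma integrable_complex_cond_exp:
  assumes "integrable M b"
  shows "integrable M (complex_cond_exp M (F n) b)"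
  unfolding complex_cond_exp_def[abs_def] Complex_eq
  using E.real_cond_exp_int(1)[OF integrable_Re[OF assms]] E.real_cond_exp_int(1)[OF integrable_Im[OF assms]]
  by (intro Bochner_Integration.integrable_add integrable_mult_right integrable_of_real)

text \<open>
  Multiply by the conjugate of the phase \<open>s\<close> of the conditional expectation, which is
  \<open>F\<^sub>n\<close>-measurable and hence passes through it: the norm becomes the conditional expectation of
  the real function \<open>Re (cnj s * b)\<close>, which is at most \<open>norm b\<close>.
\<close>

lemma norm_complex_cond_exp_le:
  assumes b: "integrable M b"
  shows "AE x in M. norm (complex_cond_exp M (F n) b x) \<le> real_cond_exp M (F n) (\<lambda>y. norm (b y)) x"
proof -
  define c where "c = complex_cond_exp M (F n) b"
  \<comment> \<open>Division by zero gives \<open>s = 0\<close> where \<open>c = 0\<close>, so that \<open>cnj s * c = norm c\<close> everywhere.\<close>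
  define s where "s x = c x / of_real (norm (c x))" for x
  have [measurable]: "c \<in> borel_measurable (F n)" unfolding c_def by (rule complex_cond_exp_measurable)
  have sF [measurable]: "s \<in> borel_measurable (F n)" unfolding s_def[abs_def] by measurable
  have [measurable]: "s \<in> borel_measurable M" by (rule measurable_F_M[OF sF])
  have "norm (s x) \<le> 1" for x by (simp add: s_def norm_divide)
  then have s_bd: "\<bar>Re (s x)\<bar> \<le> 1" "\<bar>Im (s x)\<bar> \<le> 1" "norm (s x) \<le> 1" for x
    using abs_Re_le_cmod[of "s x"] abs_Im_le_cmod[of "s x"] order_trans by blast+
  have i: "integrable M (\<lambda>x. Re (s x) * Re (b x))" "integrable M (\<lambda>x. Im (s x) * Im (b x))"
    using b s_bd by (auto intro!: integrable_bounded_mult[of _ _ 1])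
  have i': "integrable M (\<lambda>x. Re (s x) * Re (b x) + Im (s x) * Im (b x))" using i by simp
  have bM [measurable]: "b \<in> borel_measurable M" using b by simp
  have le: "Re (s x) * Re (b x) + Im (s x) * Im (b x) \<le> norm (b x)" for x
  proof -
    have "Re (s x) * Re (b x) + Im (s x) * Im (b x) = Re (cnj (s x) * b x)" by simp
    also have "\<dots> \<le> norm (s x) * norm (b x)"
      using complex_Re_le_cmod[of "cnj (s x) * b x"] by (simp add: norm_mult)
    also have "\<dots> \<le> 1 * norm (b x)" using s_bd(3) by (intro mult_right_mono) auto
    finally show ?thesis by simp
  qed
  have "AE x in M. real_cond_exp M (F n) (\<lambda>x. Re (s x) * Re (b x)) x = Re (s x) * real_cond_exp M (F n) (\<lambda>x. Re (b x)) x"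
    by (rule E.real_cond_exp_mult[OF _ _ i(1)]) simp_all
  moreover have "AE x in M. real_cond_exp M (F n) (\<lambda>x. Im (s x) * Im (b x)) x = Im (s x) * real_cond_exp M (F n) (\<lambda>x. Im (b x)) x"
    by (rule E.real_cond_exp_mult[OF _ _ i(2)]) simp_all
  moreover note E.real_cond_exp_add[OF i, of n]
  moreover have "AE x in M. real_cond_exp M (F n) (\<lambda>x. Re (s x) * Re (b x) + Im (s x) * Im (b x)) x
      \<le> real_cond_exp M (F n) (\<lambda>y. norm (b y)) x"
    by (rule E.real_cond_exp_mono) (use le i' b in auto)
  ultimately show ?thesis
  proof eventually_elim
    case (elim x)
    have "Re (s x) * real_cond_exp M (F n) (\<lambda>x. Re (b x)) x + Im (s x) * real_cond_exp M (F n) (\<lambda>x. Im (b x)) x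
        = Re (cnj (s x) * c x)"
      by (simp add: c_def complex_cond_exp_def)
    also have "cnj (s x) * c x = of_real (norm (c x))"
      unfolding s_def complex_cnj_divide complex_cnj_complex_of_real
      by (cases "c x = 0") (simp_all add: complex_norm_square[symmetric] power2_eq_square mult.commute)
    finally show ?case using elim by (simp add: c_def)
  qed
qed

text \<open>
  Conditional expectation is an orthogonal projection in \<open>L\<^sub>2\<close>.
\<close>

lemma integral_sq_diff_cond_exp_le:
  assumes q: "q \<in> borel_measurable M" "\<And>x. \<bar>q x\<bar> \<le> C"
  shows "integrable M (\<lambda>x. (q x - real_cond_exp M (F n) q x)\<^sup>2)"
    and "(\<integral>x. (q x - real_cond_exp M (F n) q x)\<^sup>2 \<partial>M) \<le> (\<integral>x. (q x)\<^sup>2 \<partial>M)"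
proof -
  define e where "e = real_cond_exp M (F n) q"
  note [measurable] = q(1)
  have [measurable]: "e \<in> borel_measurable M" unfolding e_def by simp
  have C: "0 \<le> C" using q(2) abs_ge_zero order_trans by blast
  have int_q: "integrable M q" by (rule integrable_const_bound[of _ C]) (use q in auto)
  have "-C \<le> q x" "q x \<le> C" for x using q(2)[of x] by auto
  then have e_bd: "AE x in M. \<bar>e x\<bar> \<le> C"
    using E.real_cond_exp_ge_c[OF int_q, of "-C" n] E.real_cond_exp_le_c[OF int_q, of C n]
    unfolding e_def by auto
  have sq: "integrable M (\<lambda>x. (q x)\<^sup>2)"
    by (rule integrable_const_bound[of _ "C\<^sup>2"]) (use q C in \<open>auto simp: abs_le_square_iff[symmetric]\<close>)
  have se: "integrable M (\<lambda>x. (e x)\<^sup>2)"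
    by (rule integrable_const_bound[of _ "C\<^sup>2"])
       (use e_bd C in \<open>auto simp: abs_le_square_iff[symmetric]\<close>)
  have eq: "integrable M (\<lambda>x. e x * q x)"
    by (rule integrable_const_bound[of _ "C * C"])
       (use e_bd in eventually_elim, use C q in \<open>auto simp: abs_mult intro!: mult_mono\<close>)
  have "(\<integral>x. e x * e x \<partial>M) = (\<integral>x. e x * q x \<partial>M)"
    unfolding e_def by (rule E.real_cond_exp_intg(2)) (use eq in \<open>simp_all add: e_def\<close>)
  moreover have ex: "(q x - e x)\<^sup>2 = (q x)\<^sup>2 - 2 * (e x * q x) + (e x)\<^sup>2" for x
    by (simp add: power2_eq_square algebra_simps)
  ultimately have "(\<integral>x. (q x - e x)\<^sup>2 \<partial>M) = (\<integral>x. (q x)\<^sup>2 \<partial>M) - (\<integral>x. (e x)\<^sup>2 \<partial>M)"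
    using sq se eq by (simp add: power2_eq_square)
  then show "(\<integral>x. (q x - real_cond_exp M (F n) q x)\<^sup>2 \<partial>M) \<le> (\<integral>x. (q x)\<^sup>2 \<partial>M)"
    unfolding e_def[symmetric] by simp
  show "integrable M (\<lambda>x. (q x - real_cond_exp M (F n) q x)\<^sup>2)"
    unfolding e_def[symmetric] ex using sq se eq by simp
qed

text \<open>
  The majorant in Krickeberg's decomposition: \<open>Y\<^sub>n\<close> is the limit of \<open>E\<^sub>n |f\<^bsub>n+m\<^esub>|\<close>, which
  increases with \<open>m\<close> because \<open>|f|\<close> is a submartingale. By monotone convergence its integral over
  \<open>A \<in> F\<^sub>n\<close> is the limit of \<open>\<integral>\<^sub>A |f\<^sub>m|\<close>, which does not depend on \<open>n\<close>; this is the martingale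
  property. The supremum is formed in \<open>[0, \<infinity>]\<close>, and it is almost everywhere finite.
\<close>

lemma martingale_majorant:
  assumes f: "martingale M F f" and finite: "martingale_L1_norm M f < \<infinity>"
  shows "\<exists>Y. nonneg_martingale M F Y \<and> (\<forall>n x. norm (f n x) \<le> Y n x) \<and>
    ennreal (expectation (Y 0)) \<le> martingale_L1_norm M f"
proof -
  define N where "N k x = ennreal (norm (f k x))" for k x
  define b where "b n m = nn_cond_exp M (F n) (N (n + m))" for n m
  define S where "S n x = (SUP m. b n m x)" for n x
  have fF: "f n \<in> borel_measurable (F n)" and int_f: "integrable M (f n)" for n
    using f by (auto simp: martingale_def)
  have [measurable]: "f n \<in> borel_measurable M" for n using int_f by simp
  have [measurable]: "N k \<in> borel_measurable M" for k unfolding N_def[abs_def] by simp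
  have NF: "N k \<in> borel_measurable (F k)" for k
    using fF[of k] unfolding N_def[abs_def] by simp
  have bF: "b n m \<in> borel_measurable (F n)" for n m unfolding b_def by simp
  have [measurable]: "b n m \<in> borel_measurable M" for n m unfolding b_def by simp
  have SF: "S n \<in> borel_measurable (F n)" for n
    using bF[of n] unfolding S_def[abs_def] by simp
  have [measurable]: "S n \<in> borel_measurable M" for n by (rule measurable_F_M[OF SF])
  have submart: "AE x in M. N k x \<le> nn_cond_exp M (F k) (N (Suc k)) x" for k
  proof -
    have "AE x in M. complex_cond_exp M (F k) (f (Suc k)) x = f k x" using f by (auto simp: martingale_def)
    with norm_complex_cond_exp_le[OF int_f[of "Suc k"], of k] show ?thesis
    proof eventually_elim
      case (elim x)
      have "norm (f k x) \<le> enn2real (nn_cond_exp M (F k) (N (Suc k)) x)"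
        unfolding N_def[abs_def] using elim(1)[unfolded elim(2) real_cond_exp_def] enn2real_nonneg[of "nn_cond_exp M (F k) (\<lambda>x. ennreal (- cmod (f (Suc k) x))) x"]
        by linarith
      then have "N k x \<le> ennreal (enn2real (nn_cond_exp M (F k) (N (Suc k)) x))"
        unfolding N_def[of k x] by (rule ennreal_leI)
      also have "\<dots> \<le> nn_cond_exp M (F k) (N (Suc k)) x" by (simp add: ennreal_enn2real_if)
      finally show ?case .
    qed
  qed
  have b_mono: "AE x in M. b n m x \<le> b n (Suc m) x" for n m
  proof -
    have "AE x in M. nn_cond_exp M (F n) (N (n + m)) x
        \<le> nn_cond_exp M (F n) (nn_cond_exp M (F (n + m)) (N (Suc (n + m)))) x"
      by (rule E.nn_cond_exp_mono[OF submart]) simp_all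
    moreover have "AE x in M. nn_cond_exp M (F n) (N (Suc (n + m))) x =
        nn_cond_exp M (F n) (nn_cond_exp M (F (n + m)) (N (Suc (n + m)))) x"
      by (rule E.nn_cond_exp_nested_subalg[OF subalgebra_F subalgebra_F_mono]) simp_all
    ultimately show ?thesis unfolding b_def by auto
  qed
  have b_int: "(\<integral>\<^sup>+x. indicator A x * b n m x \<partial>M) = (\<integral>\<^sup>+x. indicator A x * N (n + m) x \<partial>M)"
    if "A \<in> sets (F n)" for A n m
    unfolding b_def by (rule E.nn_cond_exp_intg) (use that in auto)
  have setsM: "A \<in> sets M" if "A \<in> sets (F n)" for A n
    using that subalgebra_F[of n] by (auto simp: subalgebra_def)
  have S_int: "(\<integral>\<^sup>+x. indicator A x * S n x \<partial>M) = (SUP m. \<integral>\<^sup>+x. indicator A x * N (n + m) x \<partial>M)"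
    if A: "A \<in> sets (F n)" for A n
  proof -
    note [measurable] = setsM[OF A]
    have "(\<integral>\<^sup>+x. indicator A x * S n x \<partial>M) = (\<integral>\<^sup>+x. (SUP m. indicator A x * b n m x) \<partial>M)"
      unfolding S_def by (simp add: SUP_mult_left_ennreal)
    also have "\<dots> = (SUP m. \<integral>\<^sup>+x. indicator A x * b n m x \<partial>M)"
    proof (rule nn_integral_monotone_convergence_SUP_AE)
      show "AE x in M. indicator A x * b n i x \<le> indicator A x * b n (Suc i) x" for i
        using b_mono[of n i] by eventually_elim (auto intro: mult_left_mono)
    qed simp
    finally show ?thesis using b_int[OF A] by simp
  qed
  have S_Suc: "(\<integral>\<^sup>+x. indicator A x * S (Suc n) x \<partial>M) = (\<integral>\<^sup>+x. indicator A x * S n x \<partial>M)"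
    if A: "A \<in> sets (F n)" for A n
  proof -
    have A': "A \<in> sets (F (Suc n))" using A subalgebra_F_mono[of n "Suc n"] by (auto simp: subalgebra_def)
    have "(\<integral>\<^sup>+x. indicator A x * N (n + m) x \<partial>M) \<le> (\<integral>\<^sup>+x. indicator A x * N (Suc n + m) x \<partial>M)" for m
    proof -
      have "(\<integral>\<^sup>+x. indicator A x * b n m x \<partial>M) \<le> (\<integral>\<^sup>+x. indicator A x * b n (Suc m) x \<partial>M)"
        by (rule nn_integral_mono_AE) (use b_mono[of n m] in \<open>eventually_elim, auto intro: mult_left_mono\<close>)
      then show ?thesis unfolding b_int[OF A] by simp
    qed
    then show ?thesis unfolding S_int[OF A] S_int[OF A']
      by (intro antisym SUP_mono) (auto intro: exI[of _ "Suc _"])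
  qed
  have S_total: "(\<integral>\<^sup>+x. S n x \<partial>M) \<le> martingale_L1_norm M f" for n
  proof -
    have "space M \<in> sets (F n)" using sets.top[of "F n"] subalgebra_F[of n] by (metis subalgebra_def)
    from S_int[OF this] have "(\<integral>\<^sup>+x. indicator (space M) x * S n x \<partial>M)
       = (SUP m. \<integral>\<^sup>+x. indicator (space M) x * N (n + m) x \<partial>M)" .
    moreover have "(\<integral>\<^sup>+x. indicator (space M) x * S n x \<partial>M) = (\<integral>\<^sup>+x. S n x \<partial>M)"
      by (rule nn_integral_cong) simp
    moreover have "(\<integral>\<^sup>+x. indicator (space M) x * N (n + m) x \<partial>M) = (\<integral>\<^sup>+x. N (n + m) x \<partial>M)" for m
      by (rule nn_integral_cong) simp
    ultimately show ?thesis
      unfolding martingale_L1_norm_def N_def by (auto intro!: SUP_least SUP_upper)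
  qed
  \<comment> \<open>The maximum changes \<open>S\<close> on a null set only and makes the domination hold at every point,
    so that the pathwise inequalities apply without exceptional sets.\<close>
  define Y where "Y n x = max (norm (f n x)) (enn2real (S n x))" for n x
  have YF: "Y n \<in> borel_measurable (F n)" for n
    using fF[of n] SF[of n] unfolding Y_def[abs_def] by simp
  have [measurable]: "Y n \<in> borel_measurable M" for n by (rule measurable_F_M[OF YF])
  have Y0: "0 \<le> Y n x" for n x by (simp add: Y_def le_max_iff_disj)
  have YS: "AE x in M. ennreal (Y n x) = S n x" for n
  proof -
    have "AE x in M. S n x \<noteq> \<infinity>"
      by (rule nn_integral_PInf_AE) (use S_total[of n] finite in auto)
    moreover have "AE x in M. N n x = b n 0 x"
      using E.nn_cond_exp_F_meas[OF NF, of n] unfolding b_def by simp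
    ultimately show ?thesis
    proof eventually_elim
      case (elim x)
      have "N n x \<le> S n x" unfolding elim(2) S_def by (rule SUP_upper) simp
      then show ?case unfolding Y_def N_def using elim(1)
        by (cases "S n x") (auto simp: max_def)
    qed
  qed
  have Y_int: "(\<integral>\<^sup>+x. ennreal (indicator A x * Y n x) \<partial>M) = (\<integral>\<^sup>+x. indicator A x * S n x \<partial>M)" for A n
  proof (rule nn_integral_cong_AE)
    show "AE x in M. ennreal (indicator A x * Y n x) = indicator A x * S n x"
      using YS[of n] by eventually_elim (auto simp: indicator_def)
  qed
  have "(\<integral>\<^sup>+x. ennreal (Y n x) \<partial>M) = (\<integral>\<^sup>+x. S n x \<partial>M)" for n
    by (rule nn_integral_cong_AE) (rule YS)
  then have Y_le: "(\<integral>\<^sup>+x. ennreal (Y n x) \<partial>M) \<le> martingale_L1_norm M f" for n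
    using S_total by simp
  have int_Y: "integrable M (Y n)" for n
    by (rule integrableI_nonneg) (use Y0 Y_le finite in \<open>auto intro: le_less_trans\<close>)
  have "nonneg_martingale M F Y"
  proof unfold_locales
    fix n
    show "AE x in M. real_cond_exp M (F n) (Y (Suc n)) x = Y n x"
    proof (rule E.real_cond_exp_charact[OF _ int_Y int_Y YF])
      fix A assume A: "A \<in> sets (F n)"
      note [measurable] = setsM[OF A]
      have "(\<integral>x. indicator A x * Y m x \<partial>M) = enn2real (\<integral>\<^sup>+x. indicator A x * S m x \<partial>M)" for m
        unfolding Y_int[symmetric] by (rule integral_eq_nn_integral) (use Y0 in auto)
      then show "(LINT x:A|M. Y (Suc n) x) = (LINT x:A|M. Y n x)"
        unfolding set_lebesgue_integral_def using S_Suc[OF A] by simp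
    qed
  qed (use YF int_Y Y0 in auto)
  moreover have "ennreal (expectation (Y 0)) \<le> martingale_L1_norm M f"
    using nn_integral_eq_integral[OF int_Y[of 0]] Y0 Y_le[of 0] by simp
  ultimately show ?thesis by (intro exI[of _ Y]) (auto simp: Y_def)
qed

end

section \<open>Weak type estimates for the two parts\<close>

lemma emeasure_less_suminf_le:
  fixes a :: "nat \<Rightarrow> 'a \<Rightarrow> ennreal"
  assumes [measurable]: "\<And>k. a k \<in> borel_measurable M"
    and bound: "\<And>N. emeasure M {x \<in> space M. u < (\<Sum>k<N. a k x)} \<le> c"
  shows "emeasure M {x \<in> space M. u < (\<Sum>k. a k x)} \<le> c"
proof -
  define A where "A N = {x \<in> space M. u < (\<Sum>k<N. a k x)}" for N
  have A: "range A \<subseteq> sets M" unfolding A_def by auto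
  have "(\<Sum>k<m. a k x) \<le> (\<Sum>k<n. a k x)" if "m \<le> n" for m n x
    by (rule sum_mono2) (use that in auto)
  then have inc: "incseq A"
    unfolding incseq_def A_def using less_le_trans by blast
  have "{x \<in> space M. u < (\<Sum>k. a k x)} = (\<Union>N. A N)"
    unfolding A_def suminf_eq_SUP by (auto simp: less_SUP_iff)
  moreover have "(SUP N. emeasure M (A N)) \<le> c"
    using bound unfolding A_def by (intro SUP_least)
  ultimately show ?thesis using SUP_emeasure_incseq[OF A inc] by simp
qed

lemma less_ennreal_sqrt_iff:
  assumes "0 \<le> t"
  shows "ennreal t < ennreal_sqrt z \<longleftrightarrow> ennreal (t\<^sup>2) < z"
proof (cases z)
  case (real r)
  have "t < sqrt r \<longleftrightarrow> t\<^sup>2 < r"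
    using assms real_less_lsqrt real_sqrt_less_iff[of "t\<^sup>2" r] by simp
  then show ?thesis using real assms by (simp add: ennreal_sqrt_def ennreal_less_iff)
qed (simp add: ennreal_sqrt_def)

lemma weak_L1_norm_leI:
  assumes "0 \<le> c" "\<And>t. 0 < t \<Longrightarrow> emeasure M {x \<in> space M. ennreal t < G x} \<le> ennreal (c / t)"
  shows "weak_L1_norm M G \<le> ennreal c"
  unfolding weak_L1_norm_def
proof (rule SUP_least)
  fix t :: real assume "t \<in> {0<..}"
  then have t: "0 < t" by simp
  have "ennreal t * emeasure M {x \<in> space M. ennreal t < G x} \<le> ennreal t * ennreal (c / t)"
    by (rule mult_left_mono[OF assms(2)[OF t]]) simp
  also have "\<dots> = ennreal c" using t assms(1) by (simp add: ennreal_mult[symmetric])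
  finally show "ennreal t * emeasure M {x \<in> space M. ennreal t < G x} \<le> ennreal c" .
qed

locale majorized_martingale = nonneg_martingale M F Y for M :: "'a measure" and F Y +
  fixes f :: "nat \<Rightarrow> 'a \<Rightarrow> complex"
  assumes martingale_f: "martingale M F f"
    and norm_f_le: "norm (f n x) \<le> Y n x"
begin

abbreviation W :: "nat \<Rightarrow> 'a \<Rightarrow> real" where "W \<equiv> running_max Y"

lemma adapted_f: "f n \<in> borel_measurable (F n)"
  and integrable_f: "integrable M (f n)"
  using martingale_f by (auto simp: martingale_def)

lemma f_measurable [measurable]: "f n \<in> borel_measurable M"
  by (rule borel_measurable_integrable[OF integrable_f])

lemma norm_f_le_running_max: "norm (f n x) \<le> W n x"
  using norm_f_le[of n x] le_running_max[of Y n x] by linarith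

lemma W_nonneg: "0 \<le> W n x"
  by (rule running_max_nonneg) (rule Y_nonneg)

lemma expectation_Y_nonneg: "0 \<le> expectation (Y 0)"
  by (rule Bochner_Integration.integral_nonneg) (rule Y_nonneg)

text \<open>
  Increments of \<open>f\<close> are orthogonal to the past; the real part of the complex pairing is all that
  the expansion of \<open>|f|\<^sup>2\<close> needs.
\<close>

lemma integral_transform_increment:
  assumes \<phi>: "\<phi> \<in> borel_measurable (F n)" "\<And>x. norm (\<phi> x) \<le> C"
  shows "integrable M (\<lambda>x. Re (cnj (\<phi> x) * (f (Suc n) x - f n x)))"
    and "(\<integral>x. Re (cnj (\<phi> x) * (f (Suc n) x - f n x)) \<partial>M) = 0"
proof -
  note m = martingale_f[unfolded martingale_Re_Im, rule_format, of n]
  have ex: "Re (cnj (\<phi> x) * (f (Suc n) x - f n x)) =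
    Re (\<phi> x) * (Re (f (Suc n) x) - Re (f n x)) + Im (\<phi> x) * (Im (f (Suc n) x) - Im (f n x))" for x
    by simp
  have [measurable]: "\<phi> \<in> borel_measurable (F n)" by (rule \<phi>(1))
  have mF: "(\<lambda>x. Re (\<phi> x)) \<in> borel_measurable (F n)" "(\<lambda>x. Im (\<phi> x)) \<in> borel_measurable (F n)" by simp_all
  have bd: "\<bar>Re (\<phi> x)\<bar> \<le> C" "\<bar>Im (\<phi> x)\<bar> \<le> C" for x
    using abs_Re_le_cmod[of "\<phi> x"] abs_Im_le_cmod[of "\<phi> x"] \<phi>(2)[of x] by linarith+
  note R = integral_mult_cond_exp_diff[OF mF(1) bd(1) integrable_Re[OF integrable_f] integrable_Re[OF integrable_f],
      OF m[THEN conjunct2, THEN conjunct2, THEN conjunct1]]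
  note I = integral_mult_cond_exp_diff[OF mF(2) bd(2) integrable_Im[OF integrable_f] integrable_Im[OF integrable_f],
      OF m[THEN conjunct2, THEN conjunct2, THEN conjunct2]]
  show "integrable M (\<lambda>x. Re (cnj (\<phi> x) * (f (Suc n) x - f n x)))"
    unfolding ex using R(1) I(1) by (rule Bochner_Integration.integrable_add)
  show "(\<integral>x. Re (cnj (\<phi> x) * (f (Suc n) x - f n x)) \<partial>M) = 0"
    unfolding ex using R I by (simp add: Bochner_Integration.integral_add del: right_diff_distrib)
qed

lemma sum_integral_sq_increment_below_le:
  assumes l: "0 \<le> l"
  shows "integrable M (\<lambda>x. indicat_real {y. W (Suc k) y \<le> l} x * (norm (f (Suc k) x - f k x))\<^sup>2)"
    and "(\<Sum>k<N. \<integral>x. indicat_real {y. W (Suc k) y \<le> l} x * (norm (f (Suc k) x - f k x))\<^sup>2 \<partial>M)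
      \<le> 2 * l * expectation (Y 0)"
proof -
  let ?S = "\<lambda>k x. indicat_real {y. W (Suc k) y \<le> l} x * (norm (f (Suc k) x - f k x))\<^sup>2"
  let ?R = "\<lambda>k x. indicat_real {y. W k y \<le> l} x * Re (cnj (f k x) * (f (Suc k) x - f k x))"
  have S: "integrable M (?S k)" for k
  proof (rule integrable_const_bound[of _ "(2 * l)\<^sup>2"])
    have "norm (f (Suc k) x - f k x) \<le> 2 * l" if "W (Suc k) x \<le> l" for x
      using norm_triangle_ineq4[of "f (Suc k) x" "f k x"] norm_f_le_running_max[of "Suc k" x]
        norm_f_le_running_max[of k x] running_max_le_Suc[of Y k x] that by linarith
    then have "?S k x \<le> (2 * l)\<^sup>2" for x
      using power_mono[of "norm (f (Suc k) x - f k x)" "2 * l" 2] l by (auto simp: indicator_def)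
    then show "AE x in M. norm (?S k x) \<le> (2 * l)\<^sup>2" by simp
    show "?S k \<in> borel_measurable M" by measurable
  qed
  have R: "integrable M (?R k)" "(\<integral>x. ?R k x \<partial>M) = 0" for k
  proof -
    define \<phi> where "\<phi> x = of_real (indicat_real {y. W k y \<le> l} x) * f k x" for x
    have eq: "?R k x = Re (cnj (\<phi> x) * (f (Suc k) x - f k x))" for x
      unfolding \<phi>_def by (simp add: indicator_def)
    have mF: "\<phi> \<in> borel_measurable (F k)" unfolding \<phi>_def[abs_def]
      using adapted_f[of k] indicator_below_measurable[of k l] by measurable
    have "norm (\<phi> x) \<le> l" for x
      using norm_f_le_running_max[of k x] l by (auto simp: \<phi>_def indicator_def norm_mult)
    then show "integrable M (?R k)" "(\<integral>x. ?R k x \<partial>M) = 0"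
      unfolding eq by (rule integral_transform_increment[OF mF])+
  qed
  have sum_eq: "(\<integral>x. (\<Sum>k<N. s k x) + 2 * (\<Sum>k<N. r k x) \<partial>M) = (\<Sum>k<N. \<integral>x. s k x \<partial>M)"
    if "\<And>k. integrable M (s k)" "\<And>k. integrable M (r k)" "\<And>k. (\<integral>x. r k x \<partial>M) = 0"
    for s r :: "nat \<Rightarrow> 'a \<Rightarrow> real"
    using that by (simp add: Bochner_Integration.integral_sum)
  have "(\<Sum>k<N. \<integral>x. ?S k x \<partial>M) = (\<integral>x. (\<Sum>k<N. ?S k x) + 2 * (\<Sum>k<N. ?R k x) \<partial>M)"
    by (rule sum_eq[OF S R, symmetric])
  also have "\<dots> \<le> (\<integral>x. 2 * l * stopped_above l Y N x \<partial>M)"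
  proof (rule integral_mono)
    show "(\<Sum>k<N. ?S k x) + 2 * (\<Sum>k<N. ?R k x) \<le> 2 * l * stopped_above l Y N x" for x
      using norm_f_le l by (intro sum_sq_diff_below_le) auto
    show "integrable M (\<lambda>x. (\<Sum>k<N. ?S k x) + 2 * (\<Sum>k<N. ?R k x))"
      by (intro Bochner_Integration.integrable_add Bochner_Integration.integrable_sum
          integrable_mult_right S R)
  qed (simp add: integrable_stopped_above)
  also have "\<dots> = 2 * l * expectation (Y 0)" by (simp add: expectation_stopped_above)
  finally show "(\<Sum>k<N. \<integral>x. ?S k x \<partial>M) \<le> 2 * l * expectation (Y 0)" .
  show "integrable M (?S k)" by (rule S)
qed

definition big_jump :: "nat \<Rightarrow> 'a \<Rightarrow> complex" where
  "big_jump k x = of_real (indicat_real {y. 2 * W k y < Y (Suc k) y} x) * (f (Suc k) x - f k x)"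

text \<open>
  The compensator \<open>complex_cond_exp M (F k) (big_jump k)\<close> turns the sum into a martingale. The whole
  initial value \<open>f\<^sub>0\<close> is put here, so that the first difference of \<open>small_jump_part\<close> vanishes.
\<close>

definition big_jump_part :: "nat \<Rightarrow> 'a \<Rightarrow> complex" where
  "big_jump_part n x = f 0 x + (\<Sum>k<n. big_jump k x - complex_cond_exp M (F k) (big_jump k) x)"

definition small_jump_part :: "nat \<Rightarrow> 'a \<Rightarrow> complex" where
  "small_jump_part n x = f n x - big_jump_part n x"

definition small_jump :: "nat \<Rightarrow> 'a \<Rightarrow> complex" where
  "small_jump k x = f (Suc k) x - f k x - big_jump k x"

lemma big_jump_adapted: "big_jump k \<in> borel_measurable (F (Suc k))"
proof -
  have [measurable]: "f (Suc k) \<in> borel_measurable (F (Suc k))" "f k \<in> borel_measurable (F (Suc k))"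
    "Y (Suc k) \<in> borel_measurable (F (Suc k))" "W k \<in> borel_measurable (F (Suc k))"
    using adapted_f measurable_F_mono[OF adapted_f[of k], of "Suc k"] adapted_Y
      measurable_F_mono[OF adapted_running_max[of k], of "Suc k"] by auto
  show ?thesis unfolding big_jump_def[abs_def] by measurable
qed

lemma big_jump_measurable [measurable]: "big_jump k \<in> borel_measurable M"
  by (rule measurable_F_M[OF big_jump_adapted])

lemma small_jump_measurable [measurable]: "small_jump k \<in> borel_measurable M"
  unfolding small_jump_def[abs_def] by measurable

lemma integrable_big_jump: "integrable M (big_jump k)"
proof (rule Bochner_Integration.integrable_bound)
  show "integrable M (\<lambda>x. f (Suc k) x - f k x)" using integrable_f by simp
  show "AE x in M. norm (big_jump k x) \<le> norm (f (Suc k) x - f k x)"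
    by (auto simp: big_jump_def norm_mult indicator_def)
qed simp

lemma norm_big_jump_le: "norm (big_jump k x) \<le> 3 * (W (Suc k) x - W k x)"
  using norm_diff_le_increment_running_max[of f x Y k, OF norm_f_le] running_max_le_Suc[of Y k x]
  by (auto simp: big_jump_def norm_mult indicator_def)

lemma mdiff_big_jump_part: "mdiff big_jump_part 0 x = f 0 x"
  "mdiff big_jump_part (Suc k) x = big_jump k x - complex_cond_exp M (F k) (big_jump k) x"
  by (simp_all add: mdiff_def big_jump_part_def)

lemma mdiff_small_jump_part: "mdiff small_jump_part 0 x = 0"
  "mdiff small_jump_part (Suc k) x = small_jump k x + complex_cond_exp M (F k) (big_jump k) x"
  by (simp_all add: mdiff_def small_jump_part_def big_jump_part_def small_jump_def)

lemma martingale_big_jump_part: "martingale M F big_jump_part"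
  unfolding martingale_Re_Im
proof (intro allI conjI)
  fix n
  have compF: "(\<lambda>x. big_jump k x - complex_cond_exp M (F k) (big_jump k) x) \<in> borel_measurable (F n)" if "k < n" for k
    using that measurable_F_mono[OF big_jump_adapted[of k], of n]
      measurable_F_mono[OF complex_cond_exp_measurable[of k "big_jump k"], of n] by simp
  show mF: "big_jump_part n \<in> borel_measurable (F n)"
    unfolding big_jump_part_def[abs_def]
    using compF measurable_F_mono[OF adapted_f[of 0], of n]
    by (intro borel_measurable_add borel_measurable_sum) auto
  show i: "integrable M (big_jump_part n)"
    unfolding big_jump_part_def[abs_def]
    using integrable_f[of 0] integrable_big_jump integrable_complex_cond_exp[OF integrable_big_jump] by simp
  have "(\<lambda>x. Re (big_jump_part n x)) \<in> borel_measurable (F n)" using mF by simp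
  from cond_exp_add_compensated[OF integrable_Re[OF i] this integrable_Re[OF integrable_big_jump]]
  show "AE x in M. real_cond_exp M (F n) (\<lambda>y. Re (big_jump_part (Suc n) y)) x = Re (big_jump_part n x)"
    by (simp add: big_jump_part_def complex_cond_exp_def add.assoc)
  have "(\<lambda>x. Im (big_jump_part n x)) \<in> borel_measurable (F n)" using mF by simp
  from cond_exp_add_compensated[OF integrable_Im[OF i] this integrable_Im[OF integrable_big_jump]]
  show "AE x in M. real_cond_exp M (F n) (\<lambda>y. Im (big_jump_part (Suc n) y)) x = Im (big_jump_part n x)"
    by (simp add: big_jump_part_def complex_cond_exp_def add.assoc)
qed

lemma martingale_small_jump_part: "martingale M F small_jump_part"
  using martingale_diff[OF martingale_f martingale_big_jump_part] unfolding small_jump_part_def[abs_def] .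

text \<open>
  The differences add up to at most three times the sum of \<open>W\<^sub>n\<close> and its compensator, whence the
  constant \<open>210 = 3 * 70\<close>.
\<close>

lemma weak_L1_norm_big_jump_part:
  "weak_L1_norm M (diff_sum big_jump_part) \<le> ennreal (210 * expectation (Y 0))"
proof (rule weak_L1_norm_leI)
  note EY = expectation_Y_nonneg
  then show "0 \<le> 210 * expectation (Y 0)" by simp
  fix t :: real assume t: "0 < t"
  define v where "v k = real_cond_exp M (F k) (\<lambda>y. W (Suc k) y - W k y)" for k
  have meas [measurable]: "(\<lambda>x. mdiff big_jump_part k x) \<in> borel_measurable M" for k
    by (cases k) (simp_all add: mdiff_big_jump_part)
  have "AE x in M. norm (complex_cond_exp M (F k) (big_jump k) x) \<le> 3 * v k x" for k
  proof -
    have iW: "integrable M (\<lambda>y. W (Suc k) y - W k y)"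
      using integrable_running_max[of "Suc k"] integrable_running_max[of k] by (rule Bochner_Integration.integrable_diff)
    have "AE x in M. real_cond_exp M (F k) (\<lambda>y. norm (big_jump k y)) x \<le>
        real_cond_exp M (F k) (\<lambda>y. 3 * (W (Suc k) y - W k y)) x"
      by (rule E.real_cond_exp_mono)
         (use norm_big_jump_le integrable_big_jump integrable_mult_right[OF iW, of 3] in
           \<open>simp_all del: running_max.simps right_diff_distrib\<close>)
    with norm_complex_cond_exp_le[OF integrable_big_jump[of k], of k] E.real_cond_exp_cmult[OF iW, of k 3]
    show ?thesis unfolding v_def by eventually_elim simp
  qed
  then have AE: "AE x in M. \<forall>k. norm (complex_cond_exp M (F k) (big_jump k) x) \<le> 3 * v k x"
    by (subst AE_all_countable) blast
  have sum_le: "AE x in M. \<forall>n. (\<Sum>k<Suc n. norm (mdiff big_jump_part k x)) \<le> 3 * (W n x + (\<Sum>k<n. v k x))"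
    using AE
  proof eventually_elim
    case (elim x)
    show ?case
    proof
      fix n
      have step: "norm (mdiff big_jump_part (Suc k) x) \<le> 3 * (W (Suc k) x - W k x) + 3 * v k x" for k
        unfolding mdiff_big_jump_part
        using norm_triangle_ineq4[of "big_jump k x" "complex_cond_exp M (F k) (big_jump k) x"]
          norm_big_jump_le[of k x] elim[rule_format, of k] by linarith
      show "(\<Sum>k<Suc n. norm (mdiff big_jump_part k x)) \<le> 3 * (W n x + (\<Sum>k<n. v k x))"
      proof (induction n)
        case 0
        then show ?case using norm_f_le_running_max[of 0 x] W_nonneg[of 0 x] by (simp add: mdiff_big_jump_part)
      next
        case (Suc n)
        then show ?case using step[of n]
          unfolding sum.lessThan_Suc[of _ "Suc n"] sum.lessThan_Suc[of "\<lambda>k. v k x" n] by argo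
      qed
    qed
  qed
  show "emeasure M {x \<in> space M. ennreal t < diff_sum big_jump_part x} \<le> ennreal (210 * expectation (Y 0) / t)"
    unfolding diff_sum_def
  proof (rule emeasure_less_suminf_le)
    fix N
    have "emeasure M {x \<in> space M. ennreal t < (\<Sum>k<N. ennreal (norm (mdiff big_jump_part k x)))}
      \<le> emeasure M {x \<in> space M. t / 3 < W N x + (\<Sum>k<N. v k x)}"
    proof (rule emeasure_mono_AE)
      show "AE x in M. x \<in> {x \<in> space M. ennreal t < (\<Sum>k<N. ennreal (norm (mdiff big_jump_part k x)))}
          \<longrightarrow> x \<in> {x \<in> space M. t / 3 < W N x + (\<Sum>k<N. v k x)}"
        using sum_le
      proof eventually_elim
        case (elim x)
        have "(\<Sum>k<N. norm (mdiff big_jump_part k x)) \<le> (\<Sum>k<Suc N. norm (mdiff big_jump_part k x))" by simp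
        also have "\<dots> \<le> 3 * (W N x + (\<Sum>k<N. v k x))" using elim by blast
        finally show ?case using t by (auto simp: sum_ennreal ennreal_less_iff)
      qed
      show "{x \<in> space M. t / 3 < W N x + (\<Sum>k<N. v k x)} \<in> sets M" unfolding v_def by measurable
    qed
    also have "\<dots> \<le> ennreal (70 * expectation (Y 0) / (t / 3))"
      unfolding emeasure_eq_measure v_def
      using t by (intro ennreal_leI prob_running_max_plus_compensator) simp
    finally show "emeasure M {x \<in> space M. ennreal t < (\<Sum>k<N. ennreal (norm (mdiff big_jump_part k x)))}
      \<le> ennreal (210 * expectation (Y 0) / t)" by (simp add: field_simps)
  qed simp
qed

text \<open>
  On \<open>W\<^sub>k \<le> t\<close> a small jump is bounded, since it vanishes unless \<open>W\<^bsub>k+1\<^esub> \<le> 2t\<close>. As increments of \<open>f\<close> have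
  conditional expectation zero, the compensator of the big jump is minus the conditional
  expectation of the small jump. So, restricted to this event of \<open>F\<^sub>k\<close>, the difference is a
  bounded function minus its conditional expectation, and subtracting the latter can only
  decrease the \<open>L\<^sub>2\<close> norm. The truncation is needed first: a small jump need not be
  square-integrable on the whole space.
\<close>

lemma integral_sq_mdiff_small_jump_part_below_le:
  assumes t: "0 < t"
  shows "(\<integral>\<^sup>+x. indicator {y. W k y \<le> t} x * ennreal ((norm (mdiff small_jump_part (Suc k) x))\<^sup>2) \<partial>M)
    \<le> ennreal (\<integral>x. indicat_real {y. W (Suc k) y \<le> 2 * t} x * (norm (f (Suc k) x - f k x))\<^sup>2 \<partial>M)"
proof -
  define I where "I = indicat_real {y. W k y \<le> t}"
  have IF: "I \<in> borel_measurable (F k)" unfolding I_def by (rule indicator_below_measurable)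
  have I01: "\<bar>I x\<bar> \<le> 1" for x by (simp add: I_def)
  have [measurable]: "I \<in> borel_measurable M" by (rule measurable_F_M[OF IF])
  have res: "small_jump k x = 0 \<or> (small_jump k x = f (Suc k) x - f k x \<and> W (Suc k) x \<le> 2 * t)"
    if "W k x \<le> t" for x
    using that t W_nonneg[of k x] by (auto simp: small_jump_def big_jump_def indicator_def)
  have sq: "I x * (norm (small_jump k x))\<^sup>2 \<le> indicat_real {y. W (Suc k) y \<le> 2 * t} x * (norm (f (Suc k) x - f k x))\<^sup>2"
    for x using res[of x] by (auto simp: I_def indicator_def)
  have bd: "norm (I x *\<^sub>R small_jump k x) \<le> 4 * t" for x
  proof (cases "W k x \<le> t")
    case True
    have "norm (f (Suc k) x - f k x) \<le> 4 * t" if "W (Suc k) x \<le> 2 * t"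
      using norm_triangle_ineq4[of "f (Suc k) x" "f k x"] norm_f_le_running_max[of "Suc k" x]
        norm_f_le_running_max[of k x] running_max_le_Suc[of Y k x] that by linarith
    then show ?thesis using res[OF True] t True by (auto simp: I_def)
  qed (use t in \<open>simp add: I_def\<close>)
  define p where "p x = I x * Re (small_jump k x)" for x
  define q where "q x = I x * Im (small_jump k x)" for x
  have [measurable]: "p \<in> borel_measurable M" "q \<in> borel_measurable M"
    unfolding p_def[abs_def] q_def[abs_def] by simp_all
  have pb: "\<bar>p x\<bar> \<le> 4 * t" and qb: "\<bar>q x\<bar> \<le> 4 * t" for x
    using abs_Re_le_cmod[of "I x *\<^sub>R small_jump k x"] abs_Im_le_cmod[of "I x *\<^sub>R small_jump k x"] bd[of x]
    by (simp_all add: p_def q_def)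
  note P = integral_sq_diff_cond_exp_le[of p "4 * t" k, OF _ pb]
  note Q = integral_sq_diff_cond_exp_le[of q "4 * t" k, OF _ qb]
  have int_res: "integrable M (small_jump k)"
    unfolding small_jump_def[abs_def] using integrable_f integrable_big_jump by simp
  note m = martingale_f[unfolded martingale_Re_Im, rule_format, of k, THEN conjunct2, THEN conjunct2]
  \<comment> \<open>The function \<open>r\<close> stands for \<open>Re\<close> and \<open>Im\<close>, which are treated alike.\<close>
  have comp: "AE x in M. I x * (r (small_jump k x) + real_cond_exp M (F k) (\<lambda>y. r (big_jump k y)) x)
      = I x * r (small_jump k x) - real_cond_exp M (F k) (\<lambda>y. I y * r (small_jump k y)) x"
    if r: "\<And>x. r (small_jump k x) = r (f (Suc k) x) - (r (f k x) + r (big_jump k x))"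
      and ir: "\<And>g. integrable M g \<Longrightarrow> integrable M (\<lambda>x. r (g x))"
      and rm: "AE x in M. real_cond_exp M (F k) (\<lambda>y. r (f (Suc k) y)) x = r (f k x)"
      and rF: "(\<lambda>x. r (f k x)) \<in> borel_measurable (F k)"
    for r :: "complex \<Rightarrow> real"
  proof -
    note i = ir[OF integrable_f] ir[OF integrable_big_jump]
    have "AE x in M. real_cond_exp M (F k) (\<lambda>y. I y * r (small_jump k y)) x
        = I x * real_cond_exp M (F k) (\<lambda>y. r (small_jump k y)) x"
      by (rule E.real_cond_exp_mult[OF IF])
         (use ir[OF int_res] in \<open>auto intro!: integrable_bounded_mult[OF _ I01]\<close>)
    moreover have "AE x in M. real_cond_exp M (F k) (\<lambda>y. r (small_jump k y)) x
        = real_cond_exp M (F k) (\<lambda>y. r (f (Suc k) y)) x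
          - real_cond_exp M (F k) (\<lambda>y. r (f k y) + r (big_jump k y)) x"
      unfolding r using i by (intro E.real_cond_exp_diff) auto
    moreover have "AE x in M. real_cond_exp M (F k) (\<lambda>y. r (f k y) + r (big_jump k y)) x
        = real_cond_exp M (F k) (\<lambda>y. r (f k y)) x + real_cond_exp M (F k) (\<lambda>y. r (big_jump k y)) x"
      using i by (intro E.real_cond_exp_add) auto
    moreover have "AE x in M. real_cond_exp M (F k) (\<lambda>y. r (f k y)) x = r (f k x)"
      using i rF by (intro E.real_cond_exp_F_meas) auto
    ultimately show ?thesis using rm by eventually_elim (simp add: algebra_simps)
  qed
  have "AE x in M. I x * (Re (small_jump k x) + real_cond_exp M (F k) (\<lambda>y. Re (big_jump k y)) x)
      = p x - real_cond_exp M (F k) p x"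
    unfolding p_def using m adapted_f[of k]
    by (intro comp) (auto simp: small_jump_def)
  moreover have "AE x in M. I x * (Im (small_jump k x) + real_cond_exp M (F k) (\<lambda>y. Im (big_jump k y)) x)
      = q x - real_cond_exp M (F k) q x"
    unfolding q_def using m adapted_f[of k]
    by (intro comp) (auto simp: small_jump_def)
  ultimately have "AE x in M. indicator {y. W k y \<le> t} x * ennreal ((norm (mdiff small_jump_part (Suc k) x))\<^sup>2)
      = ennreal ((p x - real_cond_exp M (F k) p x)\<^sup>2 + (q x - real_cond_exp M (F k) q x)\<^sup>2)"
  proof eventually_elim
    case (elim x)
    show ?case
      unfolding elim[symmetric] mdiff_small_jump_part cmod_power2
      by (auto simp: I_def indicator_def complex_cond_exp_def)
  qed
  then have "(\<integral>\<^sup>+x. indicator {y. W k y \<le> t} x * ennreal ((norm (mdiff small_jump_part (Suc k) x))\<^sup>2) \<partial>M)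
     = (\<integral>\<^sup>+x. ennreal ((p x - real_cond_exp M (F k) p x)\<^sup>2 + (q x - real_cond_exp M (F k) q x)\<^sup>2) \<partial>M)"
    by (rule nn_integral_cong_AE)
  also have "\<dots> = ennreal (\<integral>x. (p x - real_cond_exp M (F k) p x)\<^sup>2 + (q x - real_cond_exp M (F k) q x)\<^sup>2 \<partial>M)"
    using P(1) Q(1) by (intro nn_integral_eq_integral) auto
  also have "\<dots> \<le> ennreal (\<integral>x. (p x)\<^sup>2 + (q x)\<^sup>2 \<partial>M)"
  proof (rule ennreal_leI)
    have "(p x)\<^sup>2 \<le> (4 * t)\<^sup>2" "(q x)\<^sup>2 \<le> (4 * t)\<^sup>2" for x
      using power_mono[OF pb[of x], of 2] power_mono[OF qb[of x], of 2] by simp_all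
    then have "integrable M (\<lambda>x. (p x)\<^sup>2)" "integrable M (\<lambda>x. (q x)\<^sup>2)"
      by (auto intro!: integrable_const_bound[of _ "(4 * t)\<^sup>2"] simp del: power_mult_distrib)
    then show "(\<integral>x. (p x - real_cond_exp M (F k) p x)\<^sup>2 + (q x - real_cond_exp M (F k) q x)\<^sup>2 \<partial>M)
      \<le> (\<integral>x. (p x)\<^sup>2 + (q x)\<^sup>2 \<partial>M)"
      using P Q by simp
  qed
  also have "(\<integral>x. (p x)\<^sup>2 + (q x)\<^sup>2 \<partial>M) = (\<integral>x. I x * (norm (small_jump k x))\<^sup>2 \<partial>M)"
    unfolding p_def q_def cmod_power2 by (intro Bochner_Integration.integral_cong) (auto simp: I_def indicator_def)
  also have "ennreal \<dots> \<le> ennreal (\<integral>x. indicat_real {y. W (Suc k) y \<le> 2 * t} x * (norm (f (Suc k) x - f k x))\<^sup>2 \<partial>M)"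
    using t sq by (intro ennreal_leI integral_mono' sum_integral_sq_increment_below_le(1)) auto
  finally show ?thesis .
qed

text \<open>
  The contribution \<open>1\<close> to the constant comes from the event that \<open>W\<close> exceeds \<open>t\<close>, and \<open>4\<close> from
  Chebyshev's inequality at level \<open>t\<^sup>2\<close> off that event, applied to a second moment of at most
  \<open>2 (2t) E Y\<^sub>0\<close>.
\<close>

lemma weak_L1_norm_small_jump_part:
  "weak_L1_norm M (cond_square_function M F small_jump_part) \<le> ennreal (5 * expectation (Y 0))"
proof (rule weak_L1_norm_leI)
  note EY = expectation_Y_nonneg
  then show "0 \<le> 5 * expectation (Y 0)" by simp
  fix t :: real assume t: "0 < t"
  define a where "a k = nn_cond_exp M (F (k - 1)) (\<lambda>y. ennreal ((norm (mdiff small_jump_part k y))\<^sup>2))" for k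
  have [measurable]: "a k \<in> borel_measurable M" for k unfolding a_def by simp
  have mm [measurable]: "(\<lambda>x. mdiff small_jump_part k x) \<in> borel_measurable M" for k
    by (cases k) (simp_all add: mdiff_small_jump_part)
  have a0: "AE x in M. a 0 x = 0"
    using E.nn_cond_exp_F_meas[of "\<lambda>_. 0" 0] by (simp add: a_def mdiff_small_jump_part)
  define I where "I k = (indicator {y. W k y \<le> t} :: 'a \<Rightarrow> ennreal)" for k
  have IF: "I k \<in> borel_measurable (F k)" for k
  proof -
    have "(\<lambda>x. ennreal (indicat_real {y. W k y \<le> t} x)) \<in> borel_measurable (F k)"
      using indicator_below_measurable[of k t] by measurable
    then show ?thesis by (simp add: I_def ennreal_indicator)
  qed
  have [measurable]: "I k \<in> borel_measurable M" for k by (rule measurable_F_M[OF IF])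
  define X where "X = stopped_above t Y"
  have X0: "0 \<le> X n x" for n x unfolding X_def by (rule stopped_above_nonneg) (rule Y_nonneg)
  have [measurable]: "X n \<in> borel_measurable M" for n by (simp add: X_def)
  have bound: "emeasure M {x \<in> space M. ennreal (t\<^sup>2) < (\<Sum>k<Suc n. a k x)} \<le> ennreal (5 * expectation (Y 0) / t)" for n
  proof -
    let ?S = "{x \<in> space M. ennreal (t\<^sup>2) < (\<Sum>k<Suc n. a k x)}"
    have "emeasure M ?S = (\<integral>\<^sup>+x. indicator ?S x \<partial>M)" by simp
    also have "\<dots> \<le> (\<integral>\<^sup>+x. ennreal (1 / t) * ennreal (X n x) + ennreal (1 / t\<^sup>2) * (\<Sum>k<n. I k x * a (Suc k) x) \<partial>M)"
    proof (rule nn_integral_mono_AE)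
      show "AE x in M. indicator ?S x \<le> ennreal (1 / t) * ennreal (X n x) + ennreal (1 / t\<^sup>2) * (\<Sum>k<n. I k x * a (Suc k) x)"
        using a0
      proof eventually_elim
        case (elim x)
        show ?case
        proof (cases "x \<in> ?S")
          case True
          show ?thesis
          proof (cases "t < W n x")
            case big: True
            then have "t < X n x" unfolding X_def by (rule stopped_above_after)
            then have "1 \<le> ennreal (1 / t) * ennreal (X n x)"
              using t X0 by (simp add: ennreal_mult[symmetric])
            then show ?thesis using True by (simp add: add_increasing2)
          next
            case False
            have "W k x \<le> t" if "k < n" for k
              using running_max_mono[of k n Y x] that False by simp
            then have "(\<Sum>k<n. I k x * a (Suc k) x) = (\<Sum>k<n. a (Suc k) x)"
              by (intro sum.cong) (auto simp: I_def)
            also have "\<dots> = (\<Sum>k<Suc n. a k x)"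
              using elim by (simp add: sum.lessThan_Suc_shift del: sum.lessThan_Suc)
            finally have "ennreal (t\<^sup>2) \<le> (\<Sum>k<n. I k x * a (Suc k) x)" using True by (simp add: less_imp_le)
            then have "ennreal (1 / t\<^sup>2) * ennreal (t\<^sup>2) \<le> ennreal (1 / t\<^sup>2) * (\<Sum>k<n. I k x * a (Suc k) x)"
              by (rule mult_left_mono) simp
            moreover have "ennreal (1 / t\<^sup>2) * ennreal (t\<^sup>2) = 1"
              using t by (simp add: ennreal_mult[symmetric])
            ultimately show ?thesis using True by (simp add: add_increasing)
          qed
        qed simp
      qed
    qed
    also have "\<dots> = ennreal (1 / t) * (\<integral>\<^sup>+x. ennreal (X n x) \<partial>M)
        + ennreal (1 / t\<^sup>2) * (\<Sum>k<n. \<integral>\<^sup>+x. I k x * a (Suc k) x \<partial>M)"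
      by (simp add: nn_integral_add nn_integral_cmult nn_integral_sum)
    also have "(\<integral>\<^sup>+x. ennreal (X n x) \<partial>M) = ennreal (expectation (Y 0))"
      using nn_integral_eq_integral[of M "X n"] X0
      by (simp add: X_def integrable_stopped_above expectation_stopped_above)
    also have "(\<Sum>k<n. \<integral>\<^sup>+x. I k x * a (Suc k) x \<partial>M)
      \<le> (\<Sum>k<n. ennreal (\<integral>x. indicat_real {y. W (Suc k) y \<le> 2 * t} x * (norm (f (Suc k) x - f k x))\<^sup>2 \<partial>M))"
    proof (rule sum_mono)
      fix k
      have "(\<integral>\<^sup>+x. I k x * a (Suc k) x \<partial>M) = (\<integral>\<^sup>+x. I k x * ennreal ((norm (mdiff small_jump_part (Suc k) x))\<^sup>2) \<partial>M)"
        unfolding a_def diff_Suc_1 by (rule E.nn_cond_exp_intg[OF IF]) simp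
      also have "\<dots> \<le> ennreal (\<integral>x. indicat_real {y. W (Suc k) y \<le> 2 * t} x * (norm (f (Suc k) x - f k x))\<^sup>2 \<partial>M)"
        unfolding I_def by (rule integral_sq_mdiff_small_jump_part_below_le[OF t])
      finally show "(\<integral>\<^sup>+x. I k x * a (Suc k) x \<partial>M) \<le> \<dots>" .
    qed
    also have "\<dots> = ennreal (\<Sum>k<n. \<integral>x. indicat_real {y. W (Suc k) y \<le> 2 * t} x * (norm (f (Suc k) x - f k x))\<^sup>2 \<partial>M)"
      by (intro sum_ennreal integral_nonneg) auto
    also have "\<dots> \<le> ennreal (2 * (2 * t) * expectation (Y 0))"
      using t by (intro ennreal_leI sum_integral_sq_increment_below_le(2)) simp
    also have "ennreal (1 / t) * ennreal (expectation (Y 0)) + ennreal (1 / t\<^sup>2) * ennreal (2 * (2 * t) * expectation (Y 0))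
      = ennreal (5 * expectation (Y 0) / t)"
      using t EY by (simp add: ennreal_mult[symmetric] ennreal_plus[symmetric] field_simps power2_eq_square del: ennreal_plus)
    finally show ?thesis by (simp add: mult_left_mono add_left_mono)
  qed
  have "emeasure M {x \<in> space M. ennreal (t\<^sup>2) < (\<Sum>k. a k x)} \<le> ennreal (5 * expectation (Y 0) / t)"
  proof (rule emeasure_less_suminf_le)
    fix N
    show "emeasure M {x \<in> space M. ennreal (t\<^sup>2) < (\<Sum>k<N. a k x)} \<le> ennreal (5 * expectation (Y 0) / t)"
      using bound[of "N - 1"] by (cases N) auto
  qed simp
  then show "emeasure M {x \<in> space M. ennreal t < cond_square_function M F small_jump_part x} \<le> ennreal (5 * expectation (Y 0) / t)"
    using t unfolding cond_square_function_def a_def by (simp add: less_ennreal_sqrt_iff)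
qed

end

theorem theoremA:
  shows "\<exists>c::real. 0 < c \<and> c \<le> 10 ^ 6 \<and>
    (\<forall>(M :: 'a measure) (F :: nat \<Rightarrow> 'a measure) (f :: nat \<Rightarrow> 'a \<Rightarrow> complex).
       prob_space M \<longrightarrow> filtration (space M) F \<longrightarrow> (\<forall>n. subalgebra M (F n)) \<longrightarrow>
       martingale M F f \<longrightarrow> martingale_L1_norm M f < \<infinity> \<longrightarrow>
       (\<exists>g h. martingale M F g \<and> martingale M F h \<and>
          (\<forall>n. \<forall>x\<in>space M. f n x = g n x + h n x) \<and>
          weak_L1_norm M (cond_square_function M F g) + weak_L1_norm M (diff_sum h)
            \<le> ennreal c * martingale_L1_norm M f))"
proof (intro exI[of _ 215] conjI allI impI)
  fix M :: "'a measure" and F :: "nat \<Rightarrow> 'a measure" and f :: "nat \<Rightarrow> 'a \<Rightarrow> complex"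
  assume "prob_space M" "filtration (space M) F" "\<forall>n. subalgebra M (F n)"
    and f: "martingale M F f" "martingale_L1_norm M f < \<infinity>"
  then interpret filtered_prob_space M F
    by (simp add: filtered_prob_space_def filtered_prob_space_axioms_def)
  obtain Y where Y: "nonneg_martingale M F Y" "\<And>n x. norm (f n x) \<le> Y n x"
      "ennreal (expectation (Y 0)) \<le> martingale_L1_norm M f"
    using martingale_majorant[OF f] by blast
  interpret majorized_martingale M F Y f
    using Y f by (simp add: majorized_martingale_def majorized_martingale_axioms_def)
  have "weak_L1_norm M (cond_square_function M F small_jump_part) + weak_L1_norm M (diff_sum big_jump_part)
      \<le> ennreal (5 * expectation (Y 0)) + ennreal (210 * expectation (Y 0))"
    by (intro add_mono weak_L1_norm_small_jump_part weak_L1_norm_big_jump_part)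
  also have "\<dots> = ennreal 215 * ennreal (expectation (Y 0))"
    using expectation_Y_nonneg
    by (simp add: ennreal_plus[symmetric] ennreal_mult[symmetric] del: ennreal_plus ennreal_numeral)
  also have "\<dots> \<le> ennreal 215 * martingale_L1_norm M f"
    by (intro mult_left_mono Y) simp
  finally show "\<exists>g h. martingale M F g \<and> martingale M F h \<and>
      (\<forall>n. \<forall>x\<in>space M. f n x = g n x + h n x) \<and>
      weak_L1_norm M (cond_square_function M F g) + weak_L1_norm M (diff_sum h)
        \<le> ennreal 215 * martingale_L1_norm M f"
    by (intro exI[of _ small_jump_part] exI[of _ big_jump_part])
       (simp add: martingale_small_jump_part martingale_big_jump_part small_jump_part_def)
qed simp_all

end
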